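(* Let $J$ be a countable index set, let $c_j>0$ and $g_j\in L^2(\mathbb{R})$ for $j\in J$, and let $E\subset\mathbb{R}$ be a measurable set whose closure has Lebesgue measure zero. Assume that $$\sum_{j\in J}|\hat g_j(\cdot)|^2\in L^1_{\mathrm{loc}}(\mathbb{R}\setminus E).$$ If the generalized shift-invariant system $\{T_{c_jk}g_j\}_{k\in\mathbb{Z},\,j\in J}$ is a frame for $L^2(\mathbb{R})$ with lower frame bound $A$, then $$A\le \sum_{j\in J}\frac{1}{c_j}|\hat g_j(\gamma)|^2\qquad\text{for a.e. }\gamma\in\mathbb{R}.$$
   Context: $T_cf(x)=f(x-c)$ denotes translation by $c\in\mathbb{R}$. The Fourier transform is $\hat f(\gamma)=\int_{\mathbb{R}}f(x)e^{-2\pi i\gamma x}\,dx$ for $f\in L^1(\mathbb{R})$, extended to $L^2(\mathbb{R})$ as usual. A nonnegative measurable function belongs to $L^1_{\mathrm{loc}}(\mathbb{R}\setminus E)$ if it is integrable over every compact set $K\subset\mathbb{R}\setminus E$. *)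

theory Defs
  imports "HOL-Analysis.Analysis"
begin

text \<open>
  Elements of \<open>L\<^sup>2(\<real>)\<close> are represented by Lebesgue measurable functions, without passing to
  the quotient by almost-everywhere equality. Squared norms and sums of nonnegative terms
  are taken in \<^typ>\<open>ennreal\<close>, so that a divergent integral or sum is \<open>\<infinity>\<close> rather than
  the default value \<open>0\<close>.
\<close>

definition L2_norm_sq :: "(real \<Rightarrow> complex) \<Rightarrow> ennreal" where
  "L2_norm_sq f = (\<integral>\<^sup>+ x. ennreal ((cmod (f x))\<^sup>2) \<partial>lebesgue)"

definition L2 :: "(real \<Rightarrow> complex) set" where
  "L2 = {f. f \<in> borel_measurable lebesgue \<and> L2_norm_sq f < \<infinity>}"

definition L2_inner :: "(real \<Rightarrow> complex) \<Rightarrow> (real \<Rightarrow> complex) \<Rightarrow> complex" where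
  "L2_inner f g = (LINT x|lebesgue. f x * cnj (g x))"

definition translation :: "real \<Rightarrow> (real \<Rightarrow> complex) \<Rightarrow> real \<Rightarrow> complex" where
  "translation c f = (\<lambda>x. f (x - c))"

definition fourier_L1 :: "(real \<Rightarrow> complex) \<Rightarrow> real \<Rightarrow> complex" where
  "fourier_L1 f \<gamma> =
     (LINT x|lebesgue. f x * exp (- 2 * complex_of_real pi * \<i> * complex_of_real (\<gamma> * x)))"

text \<open>
  The Fourier transform on \<open>L\<^sup>2(\<real>)\<close> is the extension by continuity of \<^const>\<open>fourier_L1\<close>
  from the dense subspace \<open>L\<^sup>1(\<real>) \<inter> L\<^sup>2(\<real>)\<close>. Such an extension exists by Plancherel's theorem,
  and its value at \<open>f\<close> is determined up to a null set; the choice operator only picks a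
  representative.
\<close>

definition fourier_L2 :: "(real \<Rightarrow> complex) \<Rightarrow> real \<Rightarrow> complex" where
  "fourier_L2 f = (SOME F. F \<in> L2 \<and>
     (\<forall>h :: nat \<Rightarrow> real \<Rightarrow> complex.
        (\<forall>n. integrable lebesgue (h n) \<and> h n \<in> L2) \<longrightarrow>
        (\<lambda>n. L2_norm_sq (\<lambda>x. h n x - f x)) \<longlonglongrightarrow> 0 \<longrightarrow>
        (\<lambda>n. L2_norm_sq (\<lambda>\<gamma>. fourier_L1 (h n) \<gamma> - F \<gamma>)) \<longlonglongrightarrow> 0))"

definition L1_loc :: "real set \<Rightarrow> (real \<Rightarrow> ennreal) set" where
  "L1_loc S = {F. F \<in> borel_measurable (lebesgue_on S) \<and>
     (\<forall>K. compact K \<and> K \<subseteq> S \<longrightarrow> (\<integral>\<^sup>+ x\<in>K. F x \<partial>lebesgue) < \<infinity>)}"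

definition frame_bounds ::
  "'i set \<Rightarrow> ('i \<Rightarrow> real \<Rightarrow> complex) \<Rightarrow> real \<Rightarrow> real \<Rightarrow> bool" where
  "frame_bounds I \<phi> A B \<longleftrightarrow> 0 < A \<and> 0 < B \<and> (\<forall>i\<in>I. \<phi> i \<in> L2) \<and>
     (\<forall>f\<in>L2.
        ennreal A * L2_norm_sq f \<le> (\<Sum>\<^sub>\<infinity>i\<in>I. ennreal ((cmod (L2_inner f (\<phi> i)))\<^sup>2)) \<and>
        (\<Sum>\<^sub>\<infinity>i\<in>I. ennreal ((cmod (L2_inner f (\<phi> i)))\<^sup>2)) \<le> ennreal B * L2_norm_sq f)"

definition frame_with_lower_bound ::
  "'i set \<Rightarrow> ('i \<Rightarrow> real \<Rightarrow> complex) \<Rightarrow> real \<Rightarrow> bool" where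
  "frame_with_lower_bound I \<phi> A \<longleftrightarrow> (\<exists>B. frame_bounds I \<phi> A B)"

definition gsi_system ::
  "('j \<Rightarrow> real) \<Rightarrow> ('j \<Rightarrow> real \<Rightarrow> complex) \<Rightarrow> int \<times> 'j \<Rightarrow> real \<Rightarrow> complex" where
  "gsi_system c g = (\<lambda>(k, j). translation (c j * real_of_int k) (g j))"

end

theory Submission
  imports Defs "HOL-Probability.Probability"
begin

text \<open>
  Write \<open>F\<close> for the Fourier transform on \<open>L\<^sup>2\<close>. Let \<open>K\<close> be a compact subset of an interval of length
  \<open>\<delta>\<close> and test the lower frame inequality with the function \<open>f\<close> whose Fourier transform is the
  indicator of \<open>K\<close>. The moduli of its coefficients \<open>\<langle>f, T\<^bsub>c k\<^esub> g\<rangle>\<close> are those of the values at \<open>c k\<close> of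
  the Fourier transform of \<open>1\<^sub>K F g\<close>. Cutting the interval into at most \<open>1 + \<delta> c\<close> pieces of length at
  most \<open>1/c\<close> and applying Bessel's inequality on each piece bounds the sum of their squares over \<open>k\<close> by
  \<open>(1/c + \<delta>) \<integral>\<^sub>K |F g|\<^sup>2\<close>. Summing over \<open>j\<close>, \<open>A |K| \<le> \<integral>\<^sub>K (S + \<delta> Q)\<close> with \<open>S = \<Sum>\<^sub>j |F g\<^sub>j|\<^sup>2 / c\<^sub>j\<close> and
  \<open>Q = \<Sum>\<^sub>j |F g\<^sub>j|\<^sup>2\<close>. By inner regularity \<open>A \<le> S + \<delta> Q\<close> almost everywhere, and \<open>Q\<close> is finite almost
  everywhere by local integrability, so letting \<open>\<delta>\<close> tend to zero gives the theorem.

  Only two parts of Plancherel's theorem enter: the transform contracts the \<open>L\<^sup>2\<close> norm, and it does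
  not shrink the norm of an indicator. Both follow from the fact that the norm of the transform,
  weighted by a Gaussian, is a double integral against a normal density.
\<close>

subsection \<open>The Fourier transform of integrable functions\<close>

lemma borel_measurable_lebesgueI [intro]:
  "f \<in> borel_measurable borel \<Longrightarrow> f \<in> borel_measurable lebesgue"
  by (simp add: measurable_completion)

text \<open>Reading the coordinates of a product of completed measures as Borel maps lets Borel
  kernels such as \<open>phase (\<gamma> * x)\<close> or
  \<open>normal_density 0 \<sigma> (y - x)\<close> be proved measurable on that product.\<close>

lemma measurable_ident_lebesgue_borel [measurable]: "(\<lambda>x::real. x) \<in> lebesgue \<rightarrow>\<^sub>M borel"
  by (simp add: measurable_completion)

lemma measurable_fst_lebesgue [measurable]:
  "fst \<in> (lebesgue :: real measure) \<Otimes>\<^sub>M M \<rightarrow>\<^sub>M borel"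
  using measurable_compose[OF measurable_fst measurable_ident_lebesgue_borel, of M] by simp

lemma measurable_snd_lebesgue [measurable]:
  "snd \<in> M \<Otimes>\<^sub>M (lebesgue :: real measure) \<rightarrow>\<^sub>M borel"
  using measurable_compose[OF measurable_snd measurable_ident_lebesgue_borel, of M] by simp

text \<open>Fubini and Tonelli are applied below directly to the completed measure, in both
  variables.\<close>

lemma sigma_finite_lebesgue: "sigma_finite_measure (lebesgue :: real measure)"
proof
  show "\<exists>A. countable A \<and> A \<subseteq> sets lebesgue \<and> \<Union> A = space (lebesgue :: real measure) \<and> (\<forall>a\<in>A. emeasure lebesgue a \<noteq> \<infinity>)"
  proof (intro exI[of _ "range (\<lambda>n::nat. cball (0::real) (real n))"] conjI ballI)
    show "\<Union> (range (\<lambda>n::nat. cball (0::real) (real n))) = space lebesgue"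
      by (auto simp: real_arch_simple)
    show "\<And>a. a \<in> range (\<lambda>n::nat. cball (0::real) (real n)) \<Longrightarrow> emeasure lebesgue a \<noteq> \<infinity>"
      using emeasure_lborel_cball_finite[of "0::real"] by (auto simp: less_top)
  qed auto
qed

interpretation lebesgue: sigma_finite_measure "lebesgue :: real measure"
  by (rule sigma_finite_lebesgue)

interpretation lebesgue_pair: pair_sigma_finite "lebesgue :: real measure" "lebesgue :: real measure" ..

definition phase :: "real \<Rightarrow> complex" where
  "phase t = cis (- (2 * pi * t))"

lemma phase_add: "phase (s + t) = phase s * phase t"
  by (simp add: phase_def cis_mult algebra_simps)

lemma phase_0 [simp]: "phase 0 = 1"
  by (simp add: phase_def)

lemma norm_phase [simp]: "cmod (phase t) = 1"
  by (simp add: phase_def)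

lemma cnj_phase: "cnj (phase t) = phase (- t)"
  by (simp add: phase_def cis_cnj)

lemma borel_measurable_phase [measurable]: "phase \<in> borel_measurable borel"
  unfolding phase_def[abs_def] cis_conv_exp by measurable

lemma fourier_L1_phase: "fourier_L1 f \<gamma> = (LINT x|lebesgue. f x * phase (\<gamma> * x))"
  unfolding fourier_L1_def phase_def cis_conv_exp by (simp add: algebra_simps)

lemma measurable_phase_lebesgue [measurable]:
  "(\<lambda>x. phase (a * x)) \<in> borel_measurable lebesgue"
  by (rule borel_measurable_lebesgueI) measurable

lemma integrable_mult_phase [intro]:
  fixes f :: "real \<Rightarrow> complex"
  assumes "integrable lebesgue f"
  shows "integrable lebesgue (\<lambda>x. f x * phase (a * x))"
  using assms by (rule Bochner_Integration.integrable_bound) (use assms in \<open>auto simp: norm_mult\<close>)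

lemma borel_measurable_fourier_L1 [measurable]:
  assumes [measurable]: "f \<in> borel_measurable lebesgue"
  shows "fourier_L1 f \<in> borel_measurable lebesgue"
  unfolding fourier_L1_phase[abs_def] by measurable

lemma norm_fourier_L1_le:
  assumes "integrable lebesgue f"
  shows "cmod (fourier_L1 f \<gamma>) \<le> (LINT x|lebesgue. cmod (f x))"
proof -
  have "cmod (fourier_L1 f \<gamma>) \<le> (LINT x|lebesgue. cmod (f x * phase (\<gamma> * x)))"
    unfolding fourier_L1_phase using integrable_mult_phase[OF assms] by (intro integral_norm_bound) 
  thus ?thesis by (simp add: norm_mult)
qed

lemma fourier_L1_diff:
  assumes "integrable lebesgue f" "integrable lebesgue g"
  shows "fourier_L1 (\<lambda>x. f x - g x) \<gamma> = fourier_L1 f \<gamma> - fourier_L1 g \<gamma>"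
  unfolding fourier_L1_phase left_diff_distrib
  using integrable_mult_phase assms by (intro Bochner_Integration.integral_diff) 

text \<open>The transform of \<open>u\<close> is bounded by the L1 norm of \<open>u\<close>, and a
  bounded measurable factor preserves integrability.\<close>

lemma integrable_fourier_L1_mult:
  assumes u: "integrable lebesgue u" and v: "integrable lebesgue v"
  shows "integrable lebesgue (\<lambda>\<gamma>. fourier_L1 u \<gamma> * v \<gamma>)"
proof (rule Bochner_Integration.integrable_bound)
  have [measurable]: "u \<in> borel_measurable lebesgue" "v \<in> borel_measurable lebesgue"
    using u v by auto
  show "integrable lebesgue (\<lambda>\<gamma>. complex_of_real (LINT x|lebesgue. cmod (u x)) * v \<gamma>)"
    using v by simp
  show "(\<lambda>\<gamma>. fourier_L1 u \<gamma> * v \<gamma>) \<in> borel_measurable lebesgue"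
    by measurable
  show "AE \<gamma> in lebesgue. cmod (fourier_L1 u \<gamma> * v \<gamma>) \<le> cmod (complex_of_real (LINT x|lebesgue. cmod (u x)) * v \<gamma>)"
    using norm_fourier_L1_le[OF u]
    by (auto simp: norm_mult intro!: mult_right_mono order_trans[OF _ abs_ge_self])
qed

text \<open>Fubini for \<open>u x * v \<gamma> * phase (\<gamma> * x)\<close>, which is absolutely
  integrable because the phase has modulus one. This identity takes the place of an inversion
  formula throughout.\<close>

lemma fourier_L1_multiplication_formula:
  assumes u: "integrable lebesgue u" and v: "integrable lebesgue v"
  shows "(LINT \<gamma>|lebesgue. fourier_L1 u \<gamma> * v \<gamma>) = (LINT x|lebesgue. u x * fourier_L1 v x)"
proof -
  have [measurable]: "u \<in> borel_measurable lebesgue" "v \<in> borel_measurable lebesgue"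
    using u v by auto
  have int: "integrable (lebesgue \<Otimes>\<^sub>M lebesgue) (case_prod (\<lambda>x \<gamma>. u x * v \<gamma> * phase (\<gamma> * x)))"
  proof (rule lebesgue_pair.Fubini_integrable)
    show "case_prod (\<lambda>x \<gamma>. u x * v \<gamma> * phase (\<gamma> * x)) \<in> borel_measurable (lebesgue \<Otimes>\<^sub>M lebesgue)"
      by measurable
    show "integrable lebesgue (\<lambda>x. LINT y|lebesgue. norm (case (x, y) of (x, \<gamma>) \<Rightarrow> u x * v \<gamma> * phase (\<gamma> * x)))"
      using u by (simp add: norm_mult)
    show "AE x in lebesgue. integrable lebesgue (\<lambda>y. case (x, y) of (x, \<gamma>) \<Rightarrow> u x * v \<gamma> * phase (\<gamma> * x))"
      using integrable_mult_phase[OF v] by (simp add: mult.assoc mult.commute[of _ x for x::real])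
  qed
  have "(LINT \<gamma>|lebesgue. fourier_L1 u \<gamma> * v \<gamma>) = (LINT \<gamma>|lebesgue. LINT x|lebesgue. u x * v \<gamma> * phase (\<gamma> * x))"
    unfolding fourier_L1_phase by (subst integral_mult_left_zero[symmetric]) (simp add: ac_simps)
  also have "\<dots> = (LINT x|lebesgue. LINT \<gamma>|lebesgue. u x * v \<gamma> * phase (\<gamma> * x))"
    by (rule lebesgue_pair.Fubini_integral[OF int])
  also have "\<dots> = (LINT x|lebesgue. u x * fourier_L1 v x)"
    unfolding fourier_L1_phase by (subst integral_mult_right_zero[symmetric]) (simp add: ac_simps)
  finally show ?thesis .
qed

lemma integrable_indicator_compact:
  "compact K \<Longrightarrow> integrable lebesgue (indicator K :: real \<Rightarrow> complex)"
proof -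
  assume K: "compact K"
  hence "K \<in> sets lebesgue" "emeasure lebesgue K < \<infinity>"
    using emeasure_compact_finite[OF K] by (auto simp: borel_compact)
  from integrable_of_real[OF integrable_real_indicator[OF this], where ?'a = complex]
  show ?thesis
    by (rule iffD1[OF Bochner_Integration.integrable_cong[OF refl], rotated]) (auto simp: indicator_def)
qed

subsection \<open>Gaussian weights and the contraction property\<close>

text \<open>The characteristic function of the centred normal law with standard deviation \<sigma>,
  taken at 2 pi \<gamma>. With this normalisation its transform is exactly the density of that law,
  and it tends to 1 pointwise as \<sigma> tends to 0.\<close>

definition gauss :: "real \<Rightarrow> real \<Rightarrow> complex" where
  "gauss \<sigma> \<gamma> = of_real (exp (- (2 * pi * \<sigma> * \<gamma>)\<^sup>2 / 2))"

lemma borel_measurable_gauss [measurable]: "gauss \<sigma> \<in> borel_measurable borel"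
  unfolding gauss_def[abs_def] by measurable

lemma cmod_gauss_le: "cmod (gauss \<sigma> \<gamma>) \<le> 1"
  by (simp add: gauss_def)

text \<open>A rescaling of the known characteristic function of the standard normal law.\<close>

lemma
  assumes \<sigma>: "0 < \<sigma>"
  shows integrable_gauss: "integrable lebesgue (gauss \<sigma>)"
    and fourier_gauss: "fourier_L1 (gauss \<sigma>) t = of_real (normal_density 0 \<sigma> t)"
proof -
  define a where "a = 2 * pi * \<sigma>"
  have a: "a > 0" using \<sigma> by (simp add: a_def)
  have "has_bochner_integral lborel (\<lambda>x. std_normal_density x *\<^sub>R iexp (- (2 * pi * t / a) * x)) (exp (- ((2 * pi * t / a)\<^sup>2) / 2))"
  proof -
    have "integrable std_normal_distribution (\<lambda>x. iexp (- (2 * pi * t / a) * x))"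
      by (rule finite_measure.integrable_const_bound[of _ _ 1])
         (auto intro!: prob_space.finite_measure prob_space_normal_density)
    hence "integrable lborel (\<lambda>x. std_normal_density x *\<^sub>R iexp (- (2 * pi * t / a) * x))"
      by (subst (asm) integrable_density) auto
    moreover have "(LINT x|lborel. std_normal_density x *\<^sub>R iexp (- (2 * pi * t / a) * x)) = char std_normal_distribution (- (2 * pi * t / a))"
      unfolding char_def by (subst integral_density) auto
    ultimately show ?thesis
      by (simp add: has_bochner_integral_iff char_std_normal_distribution)
  qed
  \<comment> \<open>Replacing x by a x turns the frequency 2 pi t / a into 2 pi t and the standard
    density into a multiple of \<open>gauss \<sigma>\<close>.\<close>
  hence "has_bochner_integral lborel (\<lambda>x. std_normal_density (0 + a * x) *\<^sub>R iexp (- (2 * pi * t / a) * (0 + a * x)))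
     (of_real (exp (- ((2 * pi * t / a)\<^sup>2) / 2)) /\<^sub>R \<bar>a\<bar>)"
    using a by (subst (asm) lborel_has_bochner_integral_real_affine_iff[where c = a and t = 0]) auto
  hence "has_bochner_integral lborel (\<lambda>x. of_real (sqrt (2 * pi)) * (std_normal_density (0 + a * x) *\<^sub>R iexp (- (2 * pi * t / a) * (0 + a * x))))
     (of_real (sqrt (2 * pi)) * (of_real (exp (- ((2 * pi * t / a)\<^sup>2) / 2)) /\<^sub>R \<bar>a\<bar>))"
    by (intro has_bochner_integral_mult_right) 
  also have "(\<lambda>x. of_real (sqrt (2 * pi)) * (std_normal_density (0 + a * x) *\<^sub>R iexp (- (2 * pi * t / a) * (0 + a * x))))
      = (\<lambda>x. gauss \<sigma> x * phase (t * x))"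
  proof
    fix x
    have "2 * pi * t / a * (a * x) = 2 * pi * (t * x)" using a by simp
    moreover have "iexp (- (2 * pi * t / a) * (0 + a * x)) = cis (- (2 * pi * t / a * (a * x)))"
      by (simp add: cis_conv_exp)
    ultimately have "iexp (- (2 * pi * t / a) * (0 + a * x)) = phase (t * x)"
      by (simp only: phase_def)
    thus "of_real (sqrt (2 * pi)) * (std_normal_density (0 + a * x) *\<^sub>R iexp (- (2 * pi * t / a) * (0 + a * x)))
      = gauss \<sigma> x * phase (t * x)"
      by (simp add: gauss_def std_normal_density_def a_def scaleR_conv_of_real)
  qed
  also have "(of_real (sqrt (2 * pi)) * (of_real (exp (- ((2 * pi * t / a)\<^sup>2) / 2)) /\<^sub>R \<bar>a\<bar>))
     = complex_of_real (normal_density 0 \<sigma> t)"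
  proof -
    have "sqrt (2 * pi) * exp (- ((2 * pi * t / a)\<^sup>2) / 2) / a = normal_density 0 \<sigma> t"
    proof -
      have 1: "2 * pi * t / a = t / \<sigma>" using \<sigma> by (simp add: a_def)
      have 2: "- ((t / \<sigma>)\<^sup>2) / 2 = - (t - 0)\<^sup>2 / (2 * \<sigma>\<^sup>2)" by (simp add: power_divide)
      have 3: "sqrt (2 * pi * \<sigma>\<^sup>2) = sqrt (2 * pi) * \<sigma>" using \<sigma> by (simp add: real_sqrt_mult)
      have aa: "a = sqrt (2 * pi) * sqrt (2 * pi) * \<sigma>" by (simp add: a_def)
      have *: "s * E / (s * s * \<sigma>) = 1 / (s * \<sigma>) * E" if "s > 0" for s E :: real
        using that \<sigma> by simp
      have 4: "sqrt (2 * pi) * E / a = 1 / (sqrt (2 * pi) * \<sigma>) * E" for E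
        unfolding aa by (rule *) simp
      show ?thesis unfolding 1 2 4 normal_density_def 3 ..
    qed
    moreover have "of_real s * (of_real e /\<^sub>R \<bar>a\<bar>) = complex_of_real (s * e / a)" for s e
      using a by (simp add: scaleR_conv_of_real divide_inverse)
    ultimately show ?thesis by (simp only:)
  qed
  finally have *: "has_bochner_integral lborel (\<lambda>x. gauss \<sigma> x * phase (t * x)) (complex_of_real (normal_density 0 \<sigma> t))" .
  thus "fourier_L1 (gauss \<sigma>) t = of_real (normal_density 0 \<sigma> t)"
    unfolding fourier_L1_phase by (subst integral_completion) (auto simp: has_bochner_integral_iff)
  have "integrable lborel (\<lambda>x. gauss \<sigma> x * phase (t * x))"
    using * by (simp add: has_bochner_integral_iff)
  \<comment> \<open>The phase has modulus one, so integrability of the product gives that of the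
    Gaussian.\<close>
  hence "integrable lborel (\<lambda>x. cmod (gauss \<sigma> x * phase (t * x)))"
    by (rule integrable_norm)
  hence "integrable lborel (\<lambda>x. cmod (gauss \<sigma> x))"
    by (simp add: norm_mult)
  hence "integrable lborel (gauss \<sigma>)"
    by (subst (asm) integrable_norm_iff) auto
  thus "integrable lebesgue (gauss \<sigma>)"
    by (subst integrable_completion) auto
qed

text \<open>If \<open>f\<close> is not integrable, its Bochner integral is 0 by default and the
  bound is trivial.\<close>

lemma norm_integral_le_nn_integral:
  fixes f :: "_ \<Rightarrow> _ :: {banach, second_countable_topology}"
  shows "ennreal (norm (integral\<^sup>L M f)) \<le> (\<integral>\<^sup>+x. ennreal (norm (f x)) \<partial>M)"
  by (cases "integrable M f") (auto simp: integral_norm_bound_ennreal not_integrable_integral_eq)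

lemma nn_integral_normal_density_shift:
  assumes \<sigma>: "0 < \<sigma>"
  shows "(\<integral>\<^sup>+y. ennreal (normal_density 0 \<sigma> (y - x)) \<partial>lebesgue) = 1"
    and "(\<integral>\<^sup>+y. ennreal (normal_density 0 \<sigma> (x - y)) \<partial>lebesgue) = 1"
proof -
  have "(\<integral>\<^sup>+y. ennreal (normal_density x \<sigma> y) \<partial>lborel) = 1"
    using \<sigma> by (subst nn_integral_eq_integral) (auto simp: integrable_normal_density integral_normal_density)
  moreover have "normal_density x \<sigma> y = normal_density 0 \<sigma> (y - x)" "normal_density x \<sigma> y = normal_density 0 \<sigma> (x - y)" for y
    by (auto simp: normal_density_def power2_commute)
  ultimately show "(\<integral>\<^sup>+y. ennreal (normal_density 0 \<sigma> (y - x)) \<partial>lebesgue) = 1"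
    and "(\<integral>\<^sup>+y. ennreal (normal_density 0 \<sigma> (x - y)) \<partial>lebesgue) = 1"
    by (simp_all add: nn_integral_completion)
qed

text \<open>With F the transform of h, the left side is the integral of F times
  \<open>gauss \<sigma>\<close> times the conjugate of F. The multiplication formula moves the
  transform from h to the other two factors; their transform is the conjugate of h smoothed by the
  normal density.\<close>

lemma fourier_L1_gauss_weighted:
  assumes h: "integrable lebesgue h" and \<sigma>: "0 < \<sigma>"
  shows "(\<integral>\<^sup>+\<gamma>. ennreal (cmod (gauss \<sigma> \<gamma>) * (cmod (fourier_L1 h \<gamma>))\<^sup>2) \<partial>lebesgue)
       = ennreal (cmod (LINT x|lebesgue. h x * cnj (LINT y|lebesgue. h y * of_real (normal_density 0 \<sigma> (y - x)))))"
proof -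
  define F where "F = fourier_L1 h"
  have [measurable]: "h \<in> borel_measurable lebesgue" using h by auto
  have [measurable]: "F \<in> borel_measurable lebesgue" unfolding F_def by measurable
  have gm [measurable]: "gauss \<sigma> \<in> borel_measurable lebesgue" by (rule borel_measurable_lebesgueI) measurable
  have v: "integrable lebesgue (\<lambda>\<gamma>. gauss \<sigma> \<gamma> * cnj (F \<gamma>))"
  proof -
    have "integrable lebesgue (\<lambda>\<gamma>. F \<gamma> * gauss \<sigma> \<gamma>)"
      unfolding F_def by (rule integrable_fourier_L1_mult[OF h integrable_gauss[OF \<sigma>]])
    hence "integrable lebesgue (\<lambda>\<gamma>. cnj (F \<gamma> * gauss \<sigma> \<gamma>))" by (rule integrable_cnj)
    thus ?thesis by (simp add: gauss_def mult.commute)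
  qed
  have hat_v: "fourier_L1 (\<lambda>\<gamma>. gauss \<sigma> \<gamma> * cnj (F \<gamma>)) x
      = cnj (LINT y|lebesgue. h y * of_real (normal_density 0 \<sigma> (y - x)))" for x
  proof -
    \<comment> \<open>Modulating the Gaussian by \<open>phase (- x * \<gamma>)\<close> translates
      its transform by x.\<close>
    have hat: "fourier_L1 (\<lambda>\<gamma>. gauss \<sigma> \<gamma> * phase (- x * \<gamma>)) y = of_real (normal_density 0 \<sigma> (y - x))" for y
      by (subst fourier_gauss[OF \<sigma>, symmetric])
         (simp add: fourier_L1_phase mult.assoc phase_add[symmetric] algebra_simps)
    have "fourier_L1 (\<lambda>\<gamma>. gauss \<sigma> \<gamma> * cnj (F \<gamma>)) x = cnj (LINT \<gamma>|lebesgue. F \<gamma> * (gauss \<sigma> \<gamma> * phase (- x * \<gamma>)))"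
      unfolding fourier_L1_phase Bochner_Integration.integral_cnj[symmetric]
      by (intro Bochner_Integration.integral_cong) (simp_all add: cnj_phase gauss_def mult_ac)
    also have "(LINT \<gamma>|lebesgue. F \<gamma> * (gauss \<sigma> \<gamma> * phase (- x * \<gamma>)))
        = (LINT y|lebesgue. h y * fourier_L1 (\<lambda>\<gamma>. gauss \<sigma> \<gamma> * phase (- x * \<gamma>)) y)"
      unfolding F_def using integrable_mult_phase[OF integrable_gauss[OF \<sigma>]]
      by (intro fourier_L1_multiplication_formula h) 
    finally show ?thesis unfolding hat .
  qed
  have "integrable lebesgue (\<lambda>\<gamma>. F \<gamma> * (gauss \<sigma> \<gamma> * cnj (F \<gamma>)))"
    unfolding F_def by (rule integrable_fourier_L1_mult[OF h]) (use v in \<open>simp add: F_def\<close>)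
  moreover have eq: "F \<gamma> * (gauss \<sigma> \<gamma> * cnj (F \<gamma>)) = of_real (cmod (gauss \<sigma> \<gamma>) * (cmod (F \<gamma>))\<^sup>2)" for \<gamma>
    by (simp add: gauss_def complex_norm_square[symmetric] mult_ac)
  ultimately have int: "integrable lebesgue (\<lambda>\<gamma>. cmod (gauss \<sigma> \<gamma>) * (cmod (F \<gamma>))\<^sup>2)"
    by (simp only: complex_of_real_integrable_eq)
  hence "(\<integral>\<^sup>+\<gamma>. ennreal (cmod (gauss \<sigma> \<gamma>) * (cmod (F \<gamma>))\<^sup>2) \<partial>lebesgue) = ennreal (LINT \<gamma>|lebesgue. cmod (gauss \<sigma> \<gamma>) * (cmod (F \<gamma>))\<^sup>2)"
    by (intro nn_integral_eq_integral) auto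
  \<comment> \<open>The integral is nonnegative, hence equal to its own modulus; this gives access
    to the complex integral to which the multiplication formula applies.\<close>
  also have "(LINT \<gamma>|lebesgue. cmod (gauss \<sigma> \<gamma>) * (cmod (F \<gamma>))\<^sup>2) = cmod (of_real (LINT \<gamma>|lebesgue. cmod (gauss \<sigma> \<gamma>) * (cmod (F \<gamma>))\<^sup>2))"
    by (simp add: integral_nonneg)
  also have "of_real (LINT \<gamma>|lebesgue. cmod (gauss \<sigma> \<gamma>) * (cmod (F \<gamma>))\<^sup>2) = (LINT \<gamma>|lebesgue. F \<gamma> * (gauss \<sigma> \<gamma> * cnj (F \<gamma>)))"
    by (simp only: eq integral_complex_of_real)
  also have "\<dots> = (LINT x|lebesgue. h x * fourier_L1 (\<lambda>\<gamma>. gauss \<sigma> \<gamma> * cnj (F \<gamma>)) x)"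
    unfolding F_def by (rule fourier_L1_multiplication_formula[OF h v[unfolded F_def]])
  finally show ?thesis unfolding hat_v unfolding F_def .
qed

text \<open>The Gaussian-weighted norm is at most the norm of h for every \<sigma>, by Schur's test
  for a kernel whose integral in either variable is 1. Letting \<sigma> tend to 0, Fatou's lemma
  removes the weight.\<close>

lemma fourier_L1_contraction:
  assumes h: "integrable lebesgue h"
  shows "L2_norm_sq (fourier_L1 h) \<le> L2_norm_sq h"
proof -
  have [measurable]: "h \<in> borel_measurable lebesgue" using h by auto
  have nm [measurable]: "(\<lambda>p. normal_density 0 \<sigma> (snd p - fst p)) \<in> borel_measurable ((lebesgue :: real measure) \<Otimes>\<^sub>M (lebesgue :: real measure))" for \<sigma>
    by measurable
  have nm2 [measurable]: "(\<lambda>y. normal_density 0 \<sigma> (y - x)) \<in> borel_measurable lebesgue"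
     "(\<lambda>y. normal_density 0 \<sigma> (x - y)) \<in> borel_measurable lebesgue" for \<sigma> x
    by (rule borel_measurable_lebesgueI, measurable)+
  have bound: "(\<integral>\<^sup>+\<gamma>. ennreal (cmod (gauss \<sigma> \<gamma>) * (cmod (fourier_L1 h \<gamma>))\<^sup>2) \<partial>lebesgue) \<le> L2_norm_sq h"
    if \<sigma>: "0 < \<sigma>" for \<sigma>
  proof -
    let ?P = "\<lambda>x y. normal_density 0 \<sigma> (y - x)"
    have "ennreal (cmod (LINT x|lebesgue. h x * cnj (LINT y|lebesgue. h y * of_real (?P x y))))
      \<le> (\<integral>\<^sup>+x. ennreal (cmod (h x * cnj (LINT y|lebesgue. h y * of_real (?P x y)))) \<partial>lebesgue)"
      by (rule norm_integral_le_nn_integral)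
    also have "\<dots> \<le> (\<integral>\<^sup>+x. ennreal (cmod (h x)) * (\<integral>\<^sup>+y. ennreal (cmod (h y * of_real (?P x y))) \<partial>lebesgue) \<partial>lebesgue)"
      by (intro nn_integral_mono) (auto simp: norm_mult ennreal_mult intro!: mult_left_mono order_trans[OF norm_integral_le_nn_integral])
    also have "\<dots> = (\<integral>\<^sup>+x. (\<integral>\<^sup>+y. ennreal (cmod (h x)) * ennreal (cmod (h y * of_real (?P x y))) \<partial>lebesgue) \<partial>lebesgue)"
      by (intro nn_integral_cong nn_integral_cmult[symmetric]) measurable
    \<comment> \<open>The bound a b <= a^2/2 + b^2/2 decouples the variables: in each summand the
      kernel can be integrated out in the variable on which h does not depend, leaving half of the
      norm.\<close>
    also have "\<dots> \<le> (\<integral>\<^sup>+x. (\<integral>\<^sup>+y. ennreal ((cmod (h x))\<^sup>2 / 2) * ennreal (?P x y) + ennreal ((cmod (h y))\<^sup>2 / 2) * ennreal (?P x y) \<partial>lebesgue) \<partial>lebesgue)"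
    proof (intro nn_integral_mono)
      fix x y
      have "cmod (h x) * cmod (h y) \<le> (cmod (h x))\<^sup>2 / 2 + (cmod (h y))\<^sup>2 / 2"
        using sum_squares_bound[of "cmod (h x)" "cmod (h y)"] by simp
      hence "cmod (h x) * cmod (h y) * ?P x y \<le> ((cmod (h x))\<^sup>2 / 2 + (cmod (h y))\<^sup>2 / 2) * ?P x y"
        by (rule mult_right_mono) auto
      thus "ennreal (cmod (h x)) * ennreal (cmod (h y * of_real (?P x y))) \<le> ennreal ((cmod (h x))\<^sup>2 / 2) * ennreal (?P x y) + ennreal ((cmod (h y))\<^sup>2 / 2) * ennreal (?P x y)"
        by (simp add: norm_mult ennreal_mult[symmetric] ennreal_plus[symmetric] algebra_simps del: ennreal_plus)
    qed
    also have "\<dots> = (\<integral>\<^sup>+x. ennreal ((cmod (h x))\<^sup>2 / 2) * (\<integral>\<^sup>+y. ennreal (?P x y) \<partial>lebesgue) \<partial>lebesgue)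
        + (\<integral>\<^sup>+x. (\<integral>\<^sup>+y. ennreal ((cmod (h y))\<^sup>2 / 2) * ennreal (?P x y) \<partial>lebesgue) \<partial>lebesgue)"
      by (simp add: nn_integral_add nn_integral_cmult)
    also have "(\<integral>\<^sup>+x. (\<integral>\<^sup>+y. ennreal ((cmod (h y))\<^sup>2 / 2) * ennreal (?P x y) \<partial>lebesgue) \<partial>lebesgue)
       = (\<integral>\<^sup>+y. (\<integral>\<^sup>+x. ennreal ((cmod (h y))\<^sup>2 / 2) * ennreal (?P x y) \<partial>lebesgue) \<partial>lebesgue)"
      by (rule lebesgue_pair.Fubini'[symmetric]) measurable
    also have "\<dots> = (\<integral>\<^sup>+y. ennreal ((cmod (h y))\<^sup>2 / 2) * (\<integral>\<^sup>+x. ennreal (?P x y) \<partial>lebesgue) \<partial>lebesgue)"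
      by (simp add: nn_integral_cmult)
    also have "(\<integral>\<^sup>+x. ennreal ((cmod (h x))\<^sup>2 / 2) * (\<integral>\<^sup>+y. ennreal (?P x y) \<partial>lebesgue) \<partial>lebesgue) + \<dots>
        = (\<integral>\<^sup>+x. ennreal ((cmod (h x))\<^sup>2 / 2) + ennreal ((cmod (h x))\<^sup>2 / 2) \<partial>lebesgue)"
      by (simp add: nn_integral_normal_density_shift[OF \<sigma>] nn_integral_add)
    also have "\<dots> = L2_norm_sq h"
      unfolding L2_norm_sq_def by (simp add: ennreal_plus[symmetric] del: ennreal_plus)
    finally show ?thesis unfolding fourier_L1_gauss_weighted[OF h \<sigma>] .
  qed
  \<comment> \<open>The weights are taken along \<sigma> = 1/(n+1), which is positive for every
    n.\<close>
  let ?G = "\<lambda>n \<gamma>. ennreal (cmod (gauss (1 / real (Suc n)) \<gamma>) * (cmod (fourier_L1 h \<gamma>))\<^sup>2)"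
  have lim: "liminf (\<lambda>n. ?G n \<gamma>) = ennreal ((cmod (fourier_L1 h \<gamma>))\<^sup>2)" for \<gamma>
  proof (rule lim_imp_Liminf)
    have "(\<lambda>n. exp (- (2 * pi * (1 / real (Suc n)) * \<gamma>)\<^sup>2 / 2)) \<longlonglongrightarrow> exp (- (2 * pi * 0 * \<gamma>)\<^sup>2 / 2)"
      by (intro tendsto_intros LIMSEQ_Suc[OF lim_1_over_n]) auto
    hence "(\<lambda>n. exp (- (2 * pi * (1 / real (Suc n)) * \<gamma>)\<^sup>2 / 2) * (cmod (fourier_L1 h \<gamma>))\<^sup>2) \<longlonglongrightarrow> 1 * (cmod (fourier_L1 h \<gamma>))\<^sup>2"
      by (intro tendsto_intros) auto
    thus "(\<lambda>n. ?G n \<gamma>) \<longlonglongrightarrow> ennreal ((cmod (fourier_L1 h \<gamma>))\<^sup>2)"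
      by (intro tendsto_ennrealI) (simp add: gauss_def)
  qed auto
  have gm [measurable]: "gauss \<sigma> \<in> borel_measurable lebesgue" for \<sigma> by (rule borel_measurable_lebesgueI) measurable
  have "L2_norm_sq (fourier_L1 h) = (\<integral>\<^sup>+\<gamma>. liminf (\<lambda>n. ?G n \<gamma>) \<partial>lebesgue)"
    unfolding L2_norm_sq_def lim ..
  also have "\<dots> \<le> liminf (\<lambda>n. \<integral>\<^sup>+\<gamma>. ?G n \<gamma> \<partial>lebesgue)"
    by (rule nn_integral_liminf) measurable
  also have "\<dots> \<le> liminf (\<lambda>n::nat. L2_norm_sq h)"
    by (intro Liminf_mono always_eventually allI bound) auto
  also have "\<dots> = L2_norm_sq h" by (simp add: Liminf_const)
  finally show ?thesis .
qed

section \<open>The norm of the transform of an indicator\<close>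

lemma normal_density_tail:
  assumes \<sigma>: "0 < \<sigma>" and d: "0 < d"
  shows "(\<integral>\<^sup>+y. ennreal (normal_density 0 \<sigma> (y - x)) * indicator {y. d \<le> \<bar>y - x\<bar>} y \<partial>lebesgue) \<le> ennreal (\<sigma>\<^sup>2 / d\<^sup>2)"
proof -
  have eq: "normal_density 0 \<sigma> (y - x) = normal_density x \<sigma> y" for y
    by (simp add: normal_density_def)
  \<comment> \<open>Chebyshev's inequality: on the tail, 1 <= (y - x)^2 / d^2, and the second
    central moment is \<sigma>^2.\<close>
  have "(\<integral>\<^sup>+y. ennreal (normal_density 0 \<sigma> (y - x)) * indicator {y. d \<le> \<bar>y - x\<bar>} y \<partial>lebesgue)
     \<le> (\<integral>\<^sup>+y. ennreal (1 / d\<^sup>2 * (normal_density x \<sigma> y * (y - x)^(2*1))) \<partial>lebesgue)"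
  proof (intro nn_integral_mono)
    fix y
    show "ennreal (normal_density 0 \<sigma> (y - x)) * indicator {y. d \<le> \<bar>y - x\<bar>} y \<le> ennreal (1 / d\<^sup>2 * (normal_density x \<sigma> y * (y - x)^(2*1)))"
    proof (cases "d \<le> \<bar>y - x\<bar>")
      case True
      hence "d\<^sup>2 \<le> (y - x)\<^sup>2" using d by (simp add: abs_le_square_iff[symmetric])
      hence "normal_density x \<sigma> y * 1 \<le> normal_density x \<sigma> y * ((y - x)\<^sup>2 / d\<^sup>2)"
        using d by (intro mult_left_mono) auto
      thus ?thesis using True by (auto simp: eq intro!: ennreal_leI)
    qed auto
  qed
  also have "\<dots> = (\<integral>\<^sup>+y. ennreal (1 / d\<^sup>2 * (normal_density x \<sigma> y * (y - x)^(2*1))) \<partial>lborel)"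
    by (simp add: nn_integral_completion)
  also have "\<dots> = ennreal (1 / d\<^sup>2 * (fact (2 * 1) / ((2 / \<sigma>\<^sup>2) ^ 1 * fact 1)))"
    using has_bochner_integral_mult_right[OF normal_moment_even[OF \<sigma>, where \<mu> = x and k = 1], of "1 / d\<^sup>2"]
    by (subst nn_integral_eq_integral) (auto simp: has_bochner_integral_iff)
  also have "1 / d\<^sup>2 * (fact (2 * 1) / ((2 / \<sigma>\<^sup>2) ^ 1 * fact 1)) = \<sigma>\<^sup>2 / d\<^sup>2"
    using \<sigma> by (simp add: field_simps)
  finally show ?thesis .
qed

text \<open>A narrow normal density started in K keeps most of its mass in K. Take an open U
  containing K with U - K small, and d such that the d-balls around points of K stay in U. Mass
  leaving K either lands in U - K, which costs e in total, or travels at least d, which costs e for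
  each starting point.\<close>

lemma gauss_mass_compact:
  assumes K: "compact K" and e: "0 < (e::real)"
  obtains \<sigma> where "0 < \<sigma>"
    "emeasure lebesgue K \<le> (\<integral>\<^sup>+x\<in>K. (\<integral>\<^sup>+y\<in>K. ennreal (normal_density 0 \<sigma> (y - x)) \<partial>lebesgue) \<partial>lebesgue)
       + ennreal e + ennreal e * emeasure lebesgue K"
proof -
  have Kb [measurable]: "K \<in> sets borel" using K by (simp add: borel_compact)
  hence Kl [measurable]: "K \<in> sets lebesgue" by auto
  obtain U where U: "open U" "K \<subseteq> U" "U - K \<in> lmeasurable" "emeasure lebesgue (U - K) < ennreal e"
    using sets_lebesgue_outer_open[OF Kl e] by blast
  have UK [measurable]: "U - K \<in> sets borel" using U(1) Kb by auto
  hence UKl [measurable]: "U - K \<in> sets lebesgue" by auto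
  obtain d where d1: "d > 0" and d2: "(\<Union>x\<in>K. ball x d) \<subseteq> U"
    by (rule compact_subset_open_imp_ball_epsilon_subset[OF K U(1,2)])
  have d: "d > 0" "\<And>x. x \<in> K \<Longrightarrow> ball x d \<subseteq> U"
    using d1 d2 by auto
  \<comment> \<open>Chosen so that the Chebyshev bound \<sigma>^2 / d^2 equals e.\<close>
  define \<sigma> where "\<sigma> = d * sqrt e"
  have \<sigma>: "0 < \<sigma>" using d e by (simp add: \<sigma>_def)
  have tail: "\<sigma>\<^sup>2 / d\<^sup>2 = e" using d e by (simp add: \<sigma>_def power_mult_distrib)
  let ?P = "\<lambda>x y. ennreal (normal_density 0 \<sigma> (y - x))"
  have nm [measurable]: "(\<lambda>p. normal_density 0 \<sigma> (snd p - fst p)) \<in> borel_measurable ((lebesgue :: real measure) \<Otimes>\<^sub>M (lebesgue :: real measure))"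
    by measurable
  have nm2 [measurable]: "(\<lambda>y. normal_density 0 \<sigma> (y - x)) \<in> borel_measurable lebesgue"
     "(\<lambda>y. normal_density 0 \<sigma> (x - y)) \<in> borel_measurable lebesgue"
     "(\<lambda>y. indicator {y. d \<le> \<bar>y - x\<bar>} y :: ennreal) \<in> borel_measurable lebesgue" for x
    by (rule borel_measurable_lebesgueI, measurable)+
  have pt: "1 \<le> (\<integral>\<^sup>+y\<in>K. ?P x y \<partial>lebesgue) + (\<integral>\<^sup>+y\<in>U - K. ?P x y \<partial>lebesgue) + ennreal e" if x: "x \<in> K" for x
  proof -
    have "1 = (\<integral>\<^sup>+y. ?P x y \<partial>lebesgue)" using nn_integral_normal_density_shift[OF \<sigma>] by simp
    also have "\<dots> \<le> (\<integral>\<^sup>+y. ?P x y * indicator K y + ?P x y * indicator (U - K) y + ?P x y * indicator {y. d \<le> \<bar>y - x\<bar>} y \<partial>lebesgue)"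
    proof (intro nn_integral_mono)
      fix y
      have "y \<in> K \<or> y \<in> U - K \<or> d \<le> \<bar>y - x\<bar>"
        using d(2)[OF x] by (auto simp: subset_eq dist_real_def abs_minus_commute not_le)
      thus "?P x y \<le> ?P x y * indicator K y + ?P x y * indicator (U - K) y + ?P x y * indicator {y. d \<le> \<bar>y - x\<bar>} y"
        by (auto simp: indicator_def)
    qed
    also have "\<dots> = (\<integral>\<^sup>+y\<in>K. ?P x y \<partial>lebesgue) + (\<integral>\<^sup>+y\<in>U - K. ?P x y \<partial>lebesgue) + (\<integral>\<^sup>+y. ?P x y * indicator {y. d \<le> \<bar>y - x\<bar>} y \<partial>lebesgue)"
      by (simp add: nn_integral_add)
    also have "\<dots> \<le> (\<integral>\<^sup>+y\<in>K. ?P x y \<partial>lebesgue) + (\<integral>\<^sup>+y\<in>U - K. ?P x y \<partial>lebesgue) + ennreal e"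
      using normal_density_tail[OF \<sigma> d(1)] unfolding tail by (intro add_left_mono)
    finally show ?thesis .
  qed
  have "emeasure lebesgue K = (\<integral>\<^sup>+x\<in>K. 1 \<partial>lebesgue)"
    by (simp add: nn_integral_indicator)
  \<comment> \<open>The indicator of K is dropped from the middle term. After exchanging the
    integrals, x then runs over the whole line, the density integrates to 1, and the measure of U -
    K remains.\<close>
  also have "\<dots> \<le> (\<integral>\<^sup>+x. (\<integral>\<^sup>+y\<in>K. ?P x y \<partial>lebesgue) * indicator K x + (\<integral>\<^sup>+y\<in>U - K. ?P x y \<partial>lebesgue) + ennreal e * indicator K x \<partial>lebesgue)"
    using pt by (intro nn_integral_mono) (auto simp: indicator_def)
  also have "\<dots> = (\<integral>\<^sup>+x\<in>K. (\<integral>\<^sup>+y\<in>K. ?P x y \<partial>lebesgue) \<partial>lebesgue) + (\<integral>\<^sup>+x. (\<integral>\<^sup>+y\<in>U - K. ?P x y \<partial>lebesgue) \<partial>lebesgue) + ennreal e * emeasure lebesgue K"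
    by (simp add: nn_integral_add nn_integral_cmult_indicator)
  also have "(\<integral>\<^sup>+x. (\<integral>\<^sup>+y\<in>U - K. ?P x y \<partial>lebesgue) \<partial>lebesgue) = (\<integral>\<^sup>+y. (\<integral>\<^sup>+x. ?P x y * indicator (U - K) y \<partial>lebesgue) \<partial>lebesgue)"
    by (rule lebesgue_pair.Fubini'[symmetric]) measurable
  also have "\<dots> = (\<integral>\<^sup>+y. (\<integral>\<^sup>+x. ?P x y \<partial>lebesgue) * indicator (U - K) y \<partial>lebesgue)"
    by (intro nn_integral_cong nn_integral_multc) measurable
  also have "\<dots> = emeasure lebesgue (U - K)"
    using nn_integral_normal_density_shift[OF \<sigma>] UKl by simp
  finally have "emeasure lebesgue K \<le> (\<integral>\<^sup>+x\<in>K. (\<integral>\<^sup>+y\<in>K. ?P x y \<partial>lebesgue) \<partial>lebesgue)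
       + emeasure lebesgue (U - K) + ennreal e * emeasure lebesgue K" .
  also have "\<dots> \<le> (\<integral>\<^sup>+x\<in>K. (\<integral>\<^sup>+y\<in>K. ?P x y \<partial>lebesgue) \<partial>lebesgue) + ennreal e + ennreal e * emeasure lebesgue K"
    using U(4) by (intro add_mono) auto
  finally show thesis using that \<sigma> by blast
qed

text \<open>The Gaussian weight is at most 1, so the norm dominates every weighted norm. For an
  indicator the weighted norm is the mass that stays in K, which comes arbitrarily close to the
  measure of K.\<close>

lemma L2_norm_sq_fourier_indicator:
  assumes K: "compact K"
  shows "emeasure lebesgue K \<le> L2_norm_sq (fourier_L1 (indicator K))"
proof -
  let ?X = "L2_norm_sq (fourier_L1 (indicator K))"
  have Kb [measurable]: "K \<in> sets borel" using K by (simp add: borel_compact)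
  hence Kl [measurable]: "K \<in> sets lebesgue" by auto
  have Kfin: "emeasure lebesgue K < \<infinity>" using emeasure_compact_finite[OF K] by simp
  have h: "integrable lebesgue (indicator K :: real \<Rightarrow> complex)"
    by (rule integrable_indicator_compact) fact
  have bd: "(\<integral>\<^sup>+x\<in>K. (\<integral>\<^sup>+y\<in>K. ennreal (normal_density 0 \<sigma> (y - x)) \<partial>lebesgue) \<partial>lebesgue) \<le> ?X" if \<sigma>: "0 < \<sigma>" for \<sigma>
  proof -
    let ?P = "\<lambda>x y. normal_density 0 \<sigma> (y - x)"
    have nm [measurable]: "(\<lambda>p. normal_density 0 \<sigma> (snd p - fst p)) \<in> borel_measurable ((lebesgue :: real measure) \<Otimes>\<^sub>M (lebesgue :: real measure))"
      by measurable
    have nm2 [measurable]: "(\<lambda>y. ?P x y) \<in> borel_measurable lebesgue" for x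
      by (rule borel_measurable_lebesgueI) measurable
    \<comment> \<open>The smoothed indicator as a real Bochner integral. Its values lie in [0, 1],
      which lets the nonnegative and the complex double integrals be identified.\<close>
    define p where "p x = (LINT y|lebesgue. indicator K y * ?P x y)" for x
    have pm [measurable]: "p \<in> borel_measurable lebesgue" unfolding p_def by measurable
    have p: "ennreal (p x) = (\<integral>\<^sup>+y\<in>K. ennreal (?P x y) \<partial>lebesgue)" for x
    proof -
      have "integrable lebesgue (\<lambda>y. indicator K y * ?P x y)"
      proof (rule integrableI_bounded)
        have "(\<integral>\<^sup>+y. ennreal (norm (indicator K y * ?P x y)) \<partial>lebesgue) \<le> (\<integral>\<^sup>+y. ennreal (?P x y) \<partial>lebesgue)"
          by (intro nn_integral_mono) (auto simp: indicator_def)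
        thus "(\<integral>\<^sup>+y. ennreal (norm (indicator K y * ?P x y)) \<partial>lebesgue) < \<infinity>"
          unfolding nn_integral_normal_density_shift[OF \<sigma>] by (rule order.strict_trans1) simp
      qed measurable
      hence "ennreal (p x) = (\<integral>\<^sup>+y. ennreal (indicator K y * ?P x y) \<partial>lebesgue)"
        unfolding p_def by (intro nn_integral_eq_integral[symmetric]) auto
      also have "\<dots> = (\<integral>\<^sup>+y\<in>K. ennreal (?P x y) \<partial>lebesgue)"
        by (intro nn_integral_cong) (auto simp: indicator_def)
      finally show ?thesis .
    qed
    have p0: "0 \<le> p x" for x unfolding p_def by (intro Bochner_Integration.integral_nonneg) auto
    have p1: "p x \<le> 1" for x
    proof -
      have "ennreal (p x) \<le> (\<integral>\<^sup>+y. ennreal (?P x y) \<partial>lebesgue)"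
        unfolding p by (intro nn_integral_mono) (auto simp: indicator_def)
      thus ?thesis unfolding nn_integral_normal_density_shift[OF \<sigma>] by simp
    qed
    have "integrable lebesgue (\<lambda>x. indicator K x * p x)"
      by (rule Bochner_Integration.integrable_bound[of _ "indicator K :: real \<Rightarrow> real"])
         (use Kfin p0 p1 in \<open>auto simp: indicator_def intro!: integrable_real_indicator\<close>)
    hence "(\<integral>\<^sup>+x\<in>K. ennreal (p x) \<partial>lebesgue) = ennreal (LINT x|lebesgue. indicator K x * p x)"
      by (subst nn_integral_eq_integral[symmetric])
         (auto simp: p0 indicator_def intro!: nn_integral_cong)
    also have "(LINT x|lebesgue. indicator K x * p x) = cmod (of_real (LINT x|lebesgue. indicator K x * p x))"
      using p0 by (simp add: Bochner_Integration.integral_nonneg)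
    also have "of_real (LINT x|lebesgue. indicator K x * p x) = (LINT x|lebesgue. indicator K x * cnj (LINT y|lebesgue. indicator K y * of_real (?P x y)))"
    proof -
      have "(LINT y|lebesgue. indicator K y * of_real (?P x y)) = complex_of_real (p x)" for x
        unfolding p_def integral_complex_of_real[symmetric]
        by (intro Bochner_Integration.integral_cong) (auto simp: indicator_def)
      thus ?thesis unfolding integral_complex_of_real[symmetric]
        by (intro Bochner_Integration.integral_cong) (auto simp: indicator_def)
    qed
    finally have "(\<integral>\<^sup>+x\<in>K. ennreal (p x) \<partial>lebesgue) = (\<integral>\<^sup>+\<gamma>. ennreal (cmod (gauss \<sigma> \<gamma>) * (cmod (fourier_L1 (indicator K) \<gamma>))\<^sup>2) \<partial>lebesgue)"
      unfolding fourier_L1_gauss_weighted[OF h \<sigma>] .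
    also have "\<dots> \<le> ?X"
      unfolding L2_norm_sq_def
      by (intro nn_integral_mono ennreal_leI mult_left_le_one_le cmod_gauss_le) auto
    finally show ?thesis unfolding p .
  qed
  show ?thesis
  proof (rule ennreal_le_epsilon)
    fix e :: real assume e: "0 < e"
    define m where "m = measure lebesgue K"
    have m: "emeasure lebesgue K = ennreal m" "0 \<le> m"
      using Kfin by (auto simp: m_def emeasure_eq_ennreal_measure)
    \<comment> \<open>Makes the two errors e' and e' m add up to e; the summand 1 covers m =
      0.\<close>
    define e' where "e' = e / (1 + m)"
    have e': "0 < e'" using e m by (simp add: e'_def)
    obtain \<sigma> where \<sigma>: "0 < \<sigma>" "emeasure lebesgue K \<le> (\<integral>\<^sup>+x\<in>K. (\<integral>\<^sup>+y\<in>K. ennreal (normal_density 0 \<sigma> (y - x)) \<partial>lebesgue) \<partial>lebesgue)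
       + ennreal e' + ennreal e' * emeasure lebesgue K"
      using gauss_mass_compact[OF K e'] by blast
    have "ennreal e' + ennreal e' * ennreal m = ennreal e"
    proof -
      have "e' * (1 + m) = e" using m by (simp add: e'_def)
      thus ?thesis
        using e' m by (simp add: ennreal_mult[symmetric] ennreal_plus[symmetric] algebra_simps del: ennreal_plus)
    qed
    thus "emeasure lebesgue K \<le> ?X + ennreal e"
      using \<sigma>(2) bd[OF \<sigma>(1)] unfolding m by (simp add: add.assoc) (meson add_right_mono order_trans)
  qed
qed

subsection \<open>The Fourier transform of square-integrable functions\<close>

lemma tendsto_0_ennrealI:
  assumes "\<And>e::real. 0 < e \<Longrightarrow> eventually (\<lambda>n. f n \<le> ennreal e) F"
  shows "(f \<longlongrightarrow> (0::ennreal)) F"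
proof (rule order_tendstoI)
  fix a :: ennreal assume "0 < a"
  then obtain b where b: "0 < b" "b < a" using dense by blast
  then obtain e where e: "b = ennreal e" "0 < e"
    by (cases b) auto
  show "eventually (\<lambda>n. f n < a) F"
    using assms[OF e(2)] by eventually_elim (use b e in auto)
qed simp

lemma tendsto_0_ennrealD:
  assumes "(f \<longlongrightarrow> (0::ennreal)) F" "0 < (e::real)"
  shows "eventually (\<lambda>n. f n \<le> ennreal e) F"
  using order_tendstoD(2)[OF assms(1), of "ennreal e"] assms(2) by (auto elim: eventually_mono)

lemma borel_measurable_L2 [measurable_dest]: "f \<in> L2 \<Longrightarrow> f \<in> borel_measurable lebesgue"
  by (simp add: L2_def)

lemma L2_norm_sq_minus_commute: "L2_norm_sq (\<lambda>x. f x - g x) = L2_norm_sq (\<lambda>x. g x - f x)"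
  by (simp add: L2_norm_sq_def norm_minus_commute)

text \<open>A triangle inequality with factor 2 suffices for all limit arguments and avoids square
  roots in \<open>ennreal\<close>.\<close>

lemma L2_norm_sq_add_le:
  assumes [measurable]: "f \<in> borel_measurable lebesgue" "g \<in> borel_measurable lebesgue"
  shows "L2_norm_sq (\<lambda>x. f x + g x) \<le> 2 * L2_norm_sq f + 2 * L2_norm_sq g"
proof -
  have "(cmod (f x + g x))\<^sup>2 \<le> 2 * (cmod (f x))\<^sup>2 + 2 * (cmod (g x))\<^sup>2" for x
  proof -
    have "(cmod (f x + g x))\<^sup>2 \<le> (cmod (f x) + cmod (g x))\<^sup>2"
      by (intro power_mono norm_triangle_ineq) auto
    also have "\<dots> \<le> 2 * (cmod (f x))\<^sup>2 + 2 * (cmod (g x))\<^sup>2"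
      using sum_squares_bound[of "cmod (f x)" "cmod (g x)"] by (simp add: power2_sum)
    finally show ?thesis .
  qed
  hence "L2_norm_sq (\<lambda>x. f x + g x) \<le> (\<integral>\<^sup>+x. ennreal (2 * (cmod (f x))\<^sup>2 + 2 * (cmod (g x))\<^sup>2) \<partial>lebesgue)"
    unfolding L2_norm_sq_def by (intro nn_integral_mono ennreal_leI)
  also have "\<dots> = (\<integral>\<^sup>+x. 2 * ennreal ((cmod (f x))\<^sup>2) + 2 * ennreal ((cmod (g x))\<^sup>2) \<partial>lebesgue)"
    by (simp add: ennreal_mult)
  also have "\<dots> = 2 * L2_norm_sq f + 2 * L2_norm_sq g"
    unfolding L2_norm_sq_def by (simp add: nn_integral_add nn_integral_cmult)
  finally show ?thesis .
qed

lemma L2_norm_sq_triangle: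
  assumes "f \<in> borel_measurable lebesgue" "g \<in> borel_measurable lebesgue" "h \<in> borel_measurable lebesgue"
  shows "L2_norm_sq (\<lambda>x. f x - h x) \<le> 2 * L2_norm_sq (\<lambda>x. f x - g x) + 2 * L2_norm_sq (\<lambda>x. g x - h x)"
  using L2_norm_sq_add_le[of "\<lambda>x. f x - g x" "\<lambda>x. g x - h x"] assms by simp

lemma L2_add: "f \<in> L2 \<Longrightarrow> g \<in> L2 \<Longrightarrow> (\<lambda>x. f x + g x) \<in> L2"
  using L2_norm_sq_add_le[of f g]
  by (auto simp: L2_def ennreal_mult_less_top intro: order.strict_trans1)

lemma L2_diff: "f \<in> L2 \<Longrightarrow> g \<in> L2 \<Longrightarrow> (\<lambda>x. f x - g x) \<in> L2"
  using L2_add[of f "\<lambda>x. - g x"] by (auto simp: L2_def L2_norm_sq_def)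

text \<open>Riesz-Fischer: a rapidly Cauchy subsequence converges almost everywhere, and Fatou's
  lemma turns the pointwise limit into a limit in norm.\<close>

lemma L2_complete:
  fixes u :: "nat \<Rightarrow> real \<Rightarrow> complex"
  assumes u: "\<And>n. u n \<in> L2"
    and Cauchy: "\<And>e::real. 0 < e \<Longrightarrow> \<exists>N. \<forall>m\<ge>N. \<forall>n\<ge>N. L2_norm_sq (\<lambda>x. u m x - u n x) \<le> ennreal e"
  shows "\<exists>F\<in>L2. (\<lambda>n. L2_norm_sq (\<lambda>x. u n x - F x)) \<longlonglongrightarrow> 0"
proof -
  have um [measurable]: "u n \<in> borel_measurable lebesgue" for n
    using u by (simp add: L2_def)
  \<comment> \<open>The rate (1/4)^k leaves the summable (1/2)^k after weighting the k-th increment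
    by 2^k.\<close>
  obtain N where N: "\<And>k m n. N k \<le> m \<Longrightarrow> N k \<le> n \<Longrightarrow> L2_norm_sq (\<lambda>x. u m x - u n x) \<le> ennreal ((1/4)^k)"
    using Cauchy[of "(1/4)^k" for k] by (metis zero_less_power zero_less_divide_1_iff zero_less_numeral)
  \<comment> \<open>Partial sums make the indices nondecreasing while keeping \<open>r k\<close> at
    or beyond \<open>N k\<close>.\<close>
  define r where "r k = (\<Sum>i\<le>k. N i)" for k
  have rN: "N k \<le> r k" "N k \<le> r (Suc k)" and r_mono: "k \<le> l \<Longrightarrow> r k \<le> r l" for k l
    unfolding r_def by (auto intro: member_le_sum sum_mono2 trans_le_add1)
  have r_ge: "N k \<le> r l" if "k \<le> l" for k l
    using rN(1)[of k] r_mono[OF that] by linarith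
  define d where "d k x = u (r (Suc k)) x - u (r k) x" for k x
  have dm [measurable]: "d k \<in> borel_measurable lebesgue" for k
    unfolding d_def by measurable
  have "(\<integral>\<^sup>+x. (\<Sum>k. ennreal (2^k * (cmod (d k x))\<^sup>2)) \<partial>lebesgue) = (\<Sum>k. \<integral>\<^sup>+x. ennreal (2^k * (cmod (d k x))\<^sup>2) \<partial>lebesgue)"
    by (intro nn_integral_suminf) measurable
  also have "\<dots> \<le> (\<Sum>k. ennreal ((1/2)^k))"
  proof (intro suminf_le summableI)
    fix k
    have "(\<integral>\<^sup>+x. ennreal (2^k * (cmod (d k x))\<^sup>2) \<partial>lebesgue) = ennreal (2^k) * L2_norm_sq (d k)"
      unfolding L2_norm_sq_def by (subst nn_integral_cmult[symmetric]) (auto simp: ennreal_mult)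
    also have "\<dots> \<le> ennreal (2^k) * ennreal ((1/4)^k)"
      unfolding d_def by (intro mult_left_mono N rN) auto
    also have "\<dots> = ennreal ((1/2)^k)"
      by (simp add: ennreal_mult[symmetric] power_mult_distrib[symmetric])
    finally show "(\<integral>\<^sup>+x. ennreal (2^k * (cmod (d k x))\<^sup>2) \<partial>lebesgue) \<le> ennreal ((1/2)^k)" .
  qed
  also have "\<dots> = ennreal (\<Sum>k. (1/2)^k)"
    by (intro suminf_ennreal2 summable_geometric) auto
  also have "\<dots> < \<infinity>" by simp
  finally have "AE x in lebesgue. (\<Sum>k. ennreal (2^k * (cmod (d k x))\<^sup>2)) \<noteq> \<infinity>"
    by (intro nn_integral_PInf_AE) auto
  hence conv: "AE x in lebesgue. convergent (\<lambda>k. u (r k) x)"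
  proof eventually_elim
    fix x assume "(\<Sum>k. ennreal (2^k * (cmod (d k x))\<^sup>2)) \<noteq> \<infinity>"
    hence sm: "summable (\<lambda>k. 2^k * (cmod (d k x))\<^sup>2)"
      by (intro summable_suminf_not_top) auto
    have "summable (\<lambda>k. (1/2)^k + 2^k * (cmod (d k x))\<^sup>2)"
      by (intro summable_add sm summable_geometric) auto
    hence "summable (\<lambda>k. d k x)"
    proof (rule summable_comparison_test'[where N = 0])
      fix k
      \<comment> \<open>From (1 - 2^k a)^2 >= 0 with a = |d k x|: the weighted square summability
        implies absolute summability of the increments.\<close>
      have "2 * (1 / 2^k) * (2^k * cmod (d k x)) \<le> (1/2)^k + 2^k * (cmod (d k x))\<^sup>2"
      proof -
        define p :: real where "p = 2^k"
        have p: "p > 0" by (simp add: p_def)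
        have "0 \<le> (1 - p * cmod (d k x))\<^sup>2 / p" using p by simp
        also have "\<dots> = 1 / p + p * (cmod (d k x))\<^sup>2 - 2 * cmod (d k x)"
          using p by (simp add: power2_eq_square field_simps)
        finally show ?thesis using p by (simp add: p_def power_one_over)
      qed
      moreover have "2 * (1 / 2^k) * (2^k * cmod (d k x)) = 2 * cmod (d k x)"
        by simp
      ultimately show "norm (d k x) \<le> (1/2)^k + 2^k * (cmod (d k x))\<^sup>2"
        by (smt (verit) norm_ge_zero)
    qed
    hence "convergent (\<lambda>k. \<Sum>i<k. d i x)"
      by (simp add: summable_iff_convergent)
    hence "convergent (\<lambda>k. (\<Sum>i<k. d i x) + u (r 0) x)"
      by (intro convergent_add convergent_const)
    thus "convergent (\<lambda>k. u (r k) x)"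
      unfolding d_def by (simp add: sum_lessThan_telescope[of "\<lambda>k. u (r k) x"])
  qed
  \<comment> \<open>Off a null set this is a genuine limit; elsewhere the value of
    \<open>lim\<close> is unspecified, which the integrals do not see.\<close>
  define F where "F x = lim (\<lambda>k. u (r k) x)" for x
  have [measurable]: "F \<in> borel_measurable lebesgue"
    unfolding F_def by measurable
  have fatou: "L2_norm_sq (\<lambda>x. u n x - F x) \<le> ennreal e" if e: "\<And>m. M \<le> m \<Longrightarrow> L2_norm_sq (\<lambda>x. u n x - u (r m) x) \<le> ennreal e" for n M e
  proof -
    have "L2_norm_sq (\<lambda>x. u n x - F x) = (\<integral>\<^sup>+x. liminf (\<lambda>k. ennreal ((cmod (u n x - u (r k) x))\<^sup>2)) \<partial>lebesgue)"
      unfolding L2_norm_sq_def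
    proof (rule nn_integral_cong_AE)
      show "AE x in lebesgue. ennreal ((cmod (u n x - F x))\<^sup>2) = liminf (\<lambda>k. ennreal ((cmod (u n x - u (r k) x))\<^sup>2))"
        using conv
      proof eventually_elim
        fix x assume "convergent (\<lambda>k. u (r k) x)"
        hence "(\<lambda>k. u (r k) x) \<longlonglongrightarrow> F x"
          by (simp add: F_def convergent_LIMSEQ_iff)
        hence "(\<lambda>k. ennreal ((cmod (u n x - u (r k) x))\<^sup>2)) \<longlonglongrightarrow> ennreal ((cmod (u n x - F x))\<^sup>2)"
          by (intro tendsto_ennrealI tendsto_intros)
        thus "ennreal ((cmod (u n x - F x))\<^sup>2) = liminf (\<lambda>k. ennreal ((cmod (u n x - u (r k) x))\<^sup>2))"
          by (intro lim_imp_Liminf[symmetric]) auto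
      qed
    qed
    also have "\<dots> \<le> liminf (\<lambda>k. L2_norm_sq (\<lambda>x. u n x - u (r k) x))"
      unfolding L2_norm_sq_def by (intro nn_integral_liminf) measurable
    also have "\<dots> \<le> liminf (\<lambda>k::nat. ennreal e)"
      by (intro Liminf_mono eventually_sequentiallyI[of M] e)
    also have "\<dots> = ennreal e" by (simp add: Liminf_const)
    finally show ?thesis .
  qed
  have lim: "(\<lambda>n. L2_norm_sq (\<lambda>x. u n x - F x)) \<longlonglongrightarrow> 0"
  proof (rule tendsto_0_ennrealI)
    fix e :: real assume "0 < e"
    then obtain k where k: "(1/4)^k < e" using real_arch_pow_inv[of e "1/4"] by auto
    show "\<forall>\<^sub>F n in sequentially. L2_norm_sq (\<lambda>x. u n x - F x) \<le> ennreal e"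
    proof (rule eventually_sequentiallyI[of "N k"])
      fix n assume "N k \<le> n"
      hence "L2_norm_sq (\<lambda>x. u n x - F x) \<le> ennreal ((1/4)^k)"
        by (intro fatou[of k] N r_ge)
      also have "\<dots> \<le> ennreal e" using k by (intro ennreal_leI) auto
      finally show "L2_norm_sq (\<lambda>x. u n x - F x) \<le> ennreal e" .
    qed
  qed
  \<comment> \<open>F is square-integrable because it differs from one member of the sequence by a
    function of finite norm.\<close>
  have "L2_norm_sq (\<lambda>x. u (N 0) x - F x) \<le> ennreal ((1/4)^0)"
    by (intro fatou[of 0] N r_ge) auto
  hence "(\<lambda>x. u (N 0) x - F x) \<in> L2"
    by (auto simp: L2_def intro: order.strict_trans1)
  from L2_diff[OF u[of "N 0"] this] have "F \<in> L2" by simp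
  thus ?thesis using lim by blast
qed

text \<open>On the interval, |u| <= 1 + |u|^2.\<close>

lemma integrable_L2_bounded_support:
  assumes u: "u \<in> L2" and supp: "\<And>x. x \<notin> {a..b} \<Longrightarrow> u x = 0"
  shows "integrable lebesgue u"
proof (rule integrableI_bounded)
  show um [measurable]: "u \<in> borel_measurable lebesgue" using u by (simp add: L2_def)
  have "(\<integral>\<^sup>+x. ennreal (cmod (u x)) \<partial>lebesgue) \<le> (\<integral>\<^sup>+x. indicator {a..b} x + ennreal ((cmod (u x))\<^sup>2) \<partial>lebesgue)"
  proof (intro nn_integral_mono)
    fix x
    have "cmod (u x) \<le> 1 + (cmod (u x))\<^sup>2"
      using sum_squares_bound[of 1 "cmod (u x)"] norm_ge_zero[of "u x"] unfolding one_power2 by linarith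
    hence "ennreal (cmod (u x)) \<le> ennreal (1 + (cmod (u x))\<^sup>2)"
      by (rule ennreal_leI)
    also have "\<dots> = 1 + ennreal ((cmod (u x))\<^sup>2)"
      by simp
    finally show "ennreal (cmod (u x)) \<le> indicator {a..b} x + ennreal ((cmod (u x))\<^sup>2)"
      using supp[of x] by (cases "x \<in> {a..b}") auto
  qed
  also have "\<dots> = emeasure lebesgue {a..b} + L2_norm_sq u"
    unfolding L2_norm_sq_def by (subst nn_integral_add) auto
  also have "\<dots> < \<infinity>" using u by (simp add: L2_def emeasure_lborel_Icc_eq)
  finally show "(\<integral>\<^sup>+x. ennreal (cmod (u x)) \<partial>lebesgue) < \<infinity>" .
qed

text \<open>Truncations supply approximants that are both integrable and square-integrable; the
  convergence is dominated by |g|^2.\<close>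

lemma L2_truncation:
  fixes g :: "real \<Rightarrow> complex"
  assumes g: "g \<in> L2"
  defines "h \<equiv> (\<lambda>n::nat. \<lambda>x. indicator {- real n..real n} x * g x)"
  shows "integrable lebesgue (h n)" "h n \<in> L2" "(\<lambda>n. L2_norm_sq (\<lambda>x. h n x - g x)) \<longlonglongrightarrow> 0"
proof -
  have [measurable]: "g \<in> borel_measurable lebesgue" using g by (simp add: L2_def)
  have gfin: "(\<integral>\<^sup>+x. ennreal ((cmod (g x))\<^sup>2) \<partial>lebesgue) < \<infinity>" using g by (simp add: L2_def L2_norm_sq_def)
  have [measurable]: "h n \<in> borel_measurable lebesgue" for n
    unfolding h_def by measurable
  show hL2: "h n \<in> L2"
  proof -
    have "L2_norm_sq (h n) \<le> L2_norm_sq g"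
      unfolding L2_norm_sq_def by (intro nn_integral_mono) (auto simp: h_def indicator_def)
    thus ?thesis using gfin by (auto simp: L2_def L2_norm_sq_def)
  qed
  show "integrable lebesgue (h n)"
    by (rule integrable_L2_bounded_support[OF hL2, of "- real n" "real n"]) (auto simp: h_def indicator_def)
  have "(\<lambda>n. \<integral>\<^sup>+x. ennreal ((cmod (h n x - g x))\<^sup>2) \<partial>lebesgue) \<longlonglongrightarrow> (\<integral>\<^sup>+x. 0 \<partial>(lebesgue :: real measure))"
  proof (rule nn_integral_dominated_convergence[where w = "\<lambda>x. ennreal ((cmod (g x))\<^sup>2)"])
    show "AE x in lebesgue. (\<lambda>n. ennreal ((cmod (h n x - g x))\<^sup>2)) \<longlonglongrightarrow> 0"
    proof (rule AE_I2)
      fix x :: real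
      obtain n0 :: nat where "\<bar>x\<bar> \<le> real n0" using real_arch_simple by blast
      hence "eventually (\<lambda>n. ennreal ((cmod (h n x - g x))\<^sup>2) = 0) sequentially"
        by (intro eventually_sequentiallyI[of n0]) (auto simp: h_def indicator_def)
      thus "(\<lambda>n. ennreal ((cmod (h n x - g x))\<^sup>2)) \<longlonglongrightarrow> 0"
        by (rule tendsto_eventually)
    qed
  qed (use gfin in \<open>auto simp: h_def indicator_def\<close>)
  thus "(\<lambda>n. L2_norm_sq (\<lambda>x. h n x - g x)) \<longlonglongrightarrow> 0"
    by (simp add: L2_norm_sq_def)
qed

text \<open>Shows that the choice in \<open>fourier_L2\<close> is made from a nonempty set. By
  contraction the transforms of the truncations are Cauchy, and the transforms of any other
  approximating sequence come close to them, so they share the limit.\<close>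

lemma fourier_L2_exists:
  assumes f: "f \<in> L2"
  shows "\<exists>F. F \<in> L2 \<and>
     (\<forall>h :: nat \<Rightarrow> real \<Rightarrow> complex.
        (\<forall>n. integrable lebesgue (h n) \<and> h n \<in> L2) \<longrightarrow>
        (\<lambda>n. L2_norm_sq (\<lambda>x. h n x - f x)) \<longlonglongrightarrow> 0 \<longrightarrow>
        (\<lambda>n. L2_norm_sq (\<lambda>\<gamma>. fourier_L1 (h n) \<gamma> - F \<gamma>)) \<longlonglongrightarrow> 0)"
proof -
  have [measurable]: "f \<in> borel_measurable lebesgue" using f by (simp add: L2_def)
  \<comment> \<open>Two terms, each with the factor 2 of the triangle inequality, cost a factor
    4.\<close>
  have quarters: "2 * ennreal (e / 4) + 2 * ennreal (e / 4) = ennreal e" if "0 < e" for e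
  proof -
    have "ennreal (2 * (e / 4)) = 2 * ennreal (e / 4)"
      using that by (subst ennreal_mult) auto
    moreover have "ennreal e = ennreal (2 * (e / 4)) + ennreal (2 * (e / 4))"
      using that by (subst ennreal_plus[symmetric]) auto
    ultimately show ?thesis by (simp only:)
  qed
  define t where "t n x = indicator {- real n..real n} x * f x" for n :: nat and x
  have t: "integrable lebesgue (t n)" "t n \<in> L2" "(\<lambda>n. L2_norm_sq (\<lambda>x. t n x - f x)) \<longlonglongrightarrow> 0" for n
    using L2_truncation[OF f] unfolding t_def by auto
  have contr: "L2_norm_sq (\<lambda>x. fourier_L1 a x - fourier_L1 b x) \<le> L2_norm_sq (\<lambda>x. a x - b x)"
    if "integrable lebesgue a" "integrable lebesgue b" for a b
    using fourier_L1_contraction[of "\<lambda>x. a x - b x"] that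
    unfolding fourier_L1_diff[OF that, abs_def] by simp
  have tL2: "fourier_L1 (t n) \<in> L2" for n
    using fourier_L1_contraction[OF t(1)] t(1,2)[of n] by (auto simp: L2_def intro: order.strict_trans1)
  have close: "L2_norm_sq (\<lambda>x. fourier_L1 a x - fourier_L1 b x) \<le> ennreal e"
    if a: "integrable lebesgue a" "L2_norm_sq (\<lambda>x. a x - f x) \<le> ennreal (e / 4)"
      and b: "integrable lebesgue b" "L2_norm_sq (\<lambda>x. b x - f x) \<le> ennreal (e / 4)" and e: "e > 0" for a b e
  proof -
    have "L2_norm_sq (\<lambda>x. fourier_L1 a x - fourier_L1 b x) \<le> L2_norm_sq (\<lambda>x. a x - b x)"
      by (rule contr[OF a(1) b(1)])
    also have "\<dots> \<le> 2 * L2_norm_sq (\<lambda>x. a x - f x) + 2 * L2_norm_sq (\<lambda>x. f x - b x)"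
      by (rule L2_norm_sq_triangle) (use a b in auto)
    also have "\<dots> \<le> 2 * ennreal (e / 4) + 2 * ennreal (e / 4)"
      using a(2) b(2) by (intro add_mono mult_left_mono) (simp_all add: L2_norm_sq_minus_commute[of f])
    also have "\<dots> = ennreal e" by (rule quarters[OF e])
    finally show ?thesis .
  qed
  have ev: "eventually (\<lambda>n. L2_norm_sq (\<lambda>x. h n x - f x) \<le> ennreal (e / 4)) sequentially"
    if "(\<lambda>n. L2_norm_sq (\<lambda>x. h n x - f x)) \<longlonglongrightarrow> 0" "e > 0" for h :: "nat \<Rightarrow> real \<Rightarrow> complex" and e
    using tendsto_0_ennrealD[OF that(1), of "e / 4"] that(2) by simp
  have "\<exists>F\<in>L2. (\<lambda>n. L2_norm_sq (\<lambda>x. fourier_L1 (t n) x - F x)) \<longlonglongrightarrow> 0"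
  proof (rule L2_complete[OF tL2])
    fix e :: real assume e: "0 < e"
    from ev[OF t(3) e] obtain N where "\<And>n. N \<le> n \<Longrightarrow> L2_norm_sq (\<lambda>x. t n x - f x) \<le> ennreal (e / 4)"
      by (auto simp: eventually_sequentially)
    thus "\<exists>N. \<forall>m\<ge>N. \<forall>n\<ge>N. L2_norm_sq (\<lambda>x. fourier_L1 (t m) x - fourier_L1 (t n) x) \<le> ennreal e"
      by (intro exI[of _ N] allI impI close t e) auto
  qed
  then obtain F where F: "F \<in> L2" "(\<lambda>n. L2_norm_sq (\<lambda>x. fourier_L1 (t n) x - F x)) \<longlonglongrightarrow> 0" by blast
  have [measurable]: "F \<in> borel_measurable lebesgue" using F by (simp add: L2_def)
  show ?thesis
  proof (intro exI[of _ F] conjI F(1) allI impI)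
    fix h :: "nat \<Rightarrow> real \<Rightarrow> complex"
    assume h: "\<forall>n. integrable lebesgue (h n) \<and> h n \<in> L2" and lim: "(\<lambda>n. L2_norm_sq (\<lambda>x. h n x - f x)) \<longlonglongrightarrow> 0"
    have hm [measurable]: "h n \<in> borel_measurable lebesgue" for n using h by (simp add: L2_def)
    have tm [measurable]: "t n \<in> borel_measurable lebesgue" for n using t(2) by (simp add: L2_def)
    show "(\<lambda>n. L2_norm_sq (\<lambda>\<gamma>. fourier_L1 (h n) \<gamma> - F \<gamma>)) \<longlonglongrightarrow> 0"
    proof (rule tendsto_0_ennrealI)
      fix e :: real assume e: "0 < e"
      \<comment> \<open>The triangle inequality is used twice, once inside \<open>close\<close> with
        e/4 in place of e, so the approximants must come within e/16 of f.\<close>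
      hence e4: "0 < e / 4" by simp
      show "\<forall>\<^sub>F n in sequentially. L2_norm_sq (\<lambda>\<gamma>. fourier_L1 (h n) \<gamma> - F \<gamma>) \<le> ennreal e"
        using ev[OF lim e4] ev[OF t(3) e4] tendsto_0_ennrealD[OF F(2) e4]
      proof eventually_elim
        case (elim n)
        have "L2_norm_sq (\<lambda>\<gamma>. fourier_L1 (h n) \<gamma> - F \<gamma>) \<le>
          2 * L2_norm_sq (\<lambda>\<gamma>. fourier_L1 (h n) \<gamma> - fourier_L1 (t n) \<gamma>) + 2 * L2_norm_sq (\<lambda>\<gamma>. fourier_L1 (t n) \<gamma> - F \<gamma>)"
          by (rule L2_norm_sq_triangle) measurable
        also have "\<dots> \<le> 2 * ennreal (e / 4) + 2 * ennreal (e / 4)"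
          using h t e4 elim by (intro add_mono mult_left_mono close) auto
        also have "\<dots> = ennreal e" by (rule quarters[OF e])
        finally show ?case .
      qed
    qed
  qed
qed

lemma
  assumes f: "f \<in> L2"
  shows fourier_L2_in_L2: "fourier_L2 f \<in> L2"
    and fourier_L2_lim: "(\<And>n. integrable lebesgue (h n)) \<Longrightarrow> (\<And>n. h n \<in> L2) \<Longrightarrow>
        (\<lambda>n. L2_norm_sq (\<lambda>x. h n x - f x)) \<longlonglongrightarrow> 0 \<Longrightarrow>
        (\<lambda>n. L2_norm_sq (\<lambda>\<gamma>. fourier_L1 (h n) \<gamma> - fourier_L2 f \<gamma>)) \<longlonglongrightarrow> 0"
  using someI_ex[OF fourier_L2_exists[OF f], folded fourier_L2_def] by auto

section \<open>Pairings of square-integrable functions and the multiplication formula\<close>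

lemma L2_Cauchy_Schwarz:
  assumes f: "f \<in> L2" and g: "g \<in> L2"
  shows "(\<integral>\<^sup>+x. ennreal (cmod (f x * g x)) \<partial>lebesgue)\<^sup>2 \<le> L2_norm_sq f * L2_norm_sq g"
  using Cauchy_Schwarz_nn_integral[of "\<lambda>x. ennreal (cmod (f x))" lebesgue "\<lambda>x. ennreal (cmod (g x))"] f g
  unfolding L2_norm_sq_def by (simp add: L2_def norm_mult ennreal_mult ennreal_power)

lemma integrable_mult_L2:
  assumes f: "f \<in> L2" and g: "g \<in> L2"
  shows "integrable lebesgue (\<lambda>x. f x * g x)"
proof (rule integrableI_bounded)
  have "L2_norm_sq f * L2_norm_sq g < \<infinity>"
    using f g by (auto simp: L2_def ennreal_mult_less_top)
  from order.strict_trans1[OF L2_Cauchy_Schwarz[OF f g] this]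
  show "(\<integral>\<^sup>+x. ennreal (cmod (f x * g x)) \<partial>lebesgue) < \<infinity>"
    by (simp add: power_less_top_ennreal)
qed (use f g in \<open>auto simp: L2_def\<close>)

lemma tendsto_integral_mult_L2:
  assumes f: "f \<in> L2" and g: "g \<in> L2" and h: "\<And>n. h n \<in> L2"
    and lim: "(\<lambda>n. L2_norm_sq (\<lambda>x. h n x - g x)) \<longlonglongrightarrow> 0"
  shows "(\<lambda>n. LINT x|lebesgue. f x * h n x) \<longlonglongrightarrow> (LINT x|lebesgue. f x * g x)"
proof -
  define I where "I n = (LINT x|lebesgue. f x * (h n x - g x))" for n
  have I: "(LINT x|lebesgue. f x * h n x) - (LINT x|lebesgue. f x * g x) = I n" for n
    unfolding I_def right_diff_distrib
    by (rule Bochner_Integration.integral_diff[symmetric]) (intro integrable_mult_L2 f g h)+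
  have "(\<lambda>n. ennreal ((cmod (I n))\<^sup>2)) \<longlonglongrightarrow> 0"
  proof (rule tendsto_sandwich[of "\<lambda>_. 0"])
    show "(\<lambda>n. L2_norm_sq f * L2_norm_sq (\<lambda>x. h n x - g x)) \<longlonglongrightarrow> 0"
      using ennreal_tendsto_cmult[OF _ lim, of "L2_norm_sq f"] f by (simp add: L2_def)
    show "\<forall>\<^sub>F n in sequentially. ennreal ((cmod (I n))\<^sup>2) \<le> L2_norm_sq f * L2_norm_sq (\<lambda>x. h n x - g x)"
    proof (intro always_eventually allI)
      fix n
      have "ennreal ((cmod (I n))\<^sup>2) = (ennreal (cmod (I n)))\<^sup>2"
        by (simp add: ennreal_power)
      also have "\<dots> \<le> (\<integral>\<^sup>+x. ennreal (cmod (f x * (h n x - g x))) \<partial>lebesgue)\<^sup>2"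
        unfolding I_def by (intro power_mono norm_integral_le_nn_integral) auto
      also have "\<dots> \<le> L2_norm_sq f * L2_norm_sq (\<lambda>x. h n x - g x)"
        by (intro L2_Cauchy_Schwarz f L2_diff h g)
      finally show "ennreal ((cmod (I n))\<^sup>2) \<le> L2_norm_sq f * L2_norm_sq (\<lambda>x. h n x - g x)" .
    qed
  qed auto
  hence "(\<lambda>n. (cmod (I n))\<^sup>2) \<longlonglongrightarrow> 0"
    by (subst (asm) tendsto_ennreal_iff[of _ _ 0, simplified]) auto
  hence "(\<lambda>n. sqrt ((cmod (I n))\<^sup>2)) \<longlonglongrightarrow> sqrt 0"
    by (intro tendsto_real_sqrt)
  hence "I \<longlonglongrightarrow> 0" by (simp add: tendsto_norm_zero_iff)
  thus ?thesis unfolding I[symmetric] by (simp only: Lim_null[symmetric]) 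
qed

text \<open>The formula holds for the truncations of g, and both sides are continuous in g: the left
  by Cauchy-Schwarz, the right also by the definition of the extended transform.\<close>

lemma fourier_L2_multiplication_formula:
  assumes u: "integrable lebesgue u" "u \<in> L2" and g: "g \<in> L2"
  shows "(LINT \<gamma>|lebesgue. fourier_L1 u \<gamma> * g \<gamma>) = (LINT x|lebesgue. u x * fourier_L2 g x)"
proof (rule LIMSEQ_unique)
  define t where "t n x = indicator {- real n..real n} x * g x" for n :: nat and x
  have t: "integrable lebesgue (t n)" "t n \<in> L2" "(\<lambda>n. L2_norm_sq (\<lambda>x. t n x - g x)) \<longlonglongrightarrow> 0" for n
    using L2_truncation[OF g] unfolding t_def by auto
  have fL2: "fourier_L1 v \<in> L2" if "integrable lebesgue v" "v \<in> L2" for v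
    using fourier_L1_contraction[OF that(1)] that by (auto simp: L2_def intro: order.strict_trans1)
  show "(\<lambda>n. LINT \<gamma>|lebesgue. fourier_L1 u \<gamma> * t n \<gamma>) \<longlonglongrightarrow> (LINT \<gamma>|lebesgue. fourier_L1 u \<gamma> * g \<gamma>)"
    by (intro tendsto_integral_mult_L2 fL2 u g t)
  have "(\<lambda>n. LINT x|lebesgue. u x * fourier_L1 (t n) x) \<longlonglongrightarrow> (LINT x|lebesgue. u x * fourier_L2 g x)"
    by (intro tendsto_integral_mult_L2 fourier_L2_in_L2 fourier_L2_lim fL2 u g t)
  thus "(\<lambda>n. LINT \<gamma>|lebesgue. fourier_L1 u \<gamma> * t n \<gamma>) \<longlonglongrightarrow> (LINT x|lebesgue. u x * fourier_L2 g x)"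
    by (subst fourier_L1_multiplication_formula[OF u(1) t(1)])
qed

subsection \<open>Bessel's inequality for exponentials\<close>

lemma phase_of_int [simp]: "phase (of_int m) = 1"
proof -
  have "cis (2 * pi * of_int (- m)) = 1" by (rule cis_multiple_2pi) auto
  thus ?thesis by (simp add: phase_def)
qed

lemma has_vector_derivative_phase:
  "((\<lambda>x. phase (b * x)) has_vector_derivative phase (b * x) * (- (2 * pi * b) * \<i>)) (at x within S)"
proof -
  have eq: "phase (b * y) = exp (y *\<^sub>R (- (2 * pi * b) * \<i>))" for y
    by (simp add: phase_def cis_conv_exp scaleR_conv_of_real mult_ac)
  show ?thesis unfolding eq by (rule exp_scaleR_has_vector_derivative_right)
qed

text \<open>The interval is a period of each of these exponentials, so for m nonzero the primitive
  takes the same value at both ends.\<close>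

lemma integral_phase_period:
  fixes m :: int
  assumes c: "0 < c"
  shows "(LINT x|lebesgue. indicator {a..a + 1 / c} x * phase (c * of_int m * x)) = (if m = 0 then of_real (1 / c) else 0)"
proof (cases "m = 0")
  case True
  have "(LINT x|lebesgue. indicator {a..a + 1 / c} x * phase (c * of_int m * x)) = (LINT x|lebesgue. complex_of_real (indicator {a..a + 1 / c} x))"
    using True by (intro Bochner_Integration.integral_cong) (auto simp: indicator_def)
  also have "\<dots> = of_real (measure lebesgue {a..a + 1 / c})"
    unfolding integral_complex_of_real by simp
  finally show ?thesis using True c by simp
next
  case False
  define b where "b = c * of_int m"
  have b: "b \<noteq> 0" using c False by (simp add: b_def)
  define w where "w = - (2 * pi * b) * \<i>"
  have w: "w \<noteq> 0" using b by (simp add: w_def)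
  have cont: "continuous_on S (\<lambda>x. phase (b * x))" for S
    unfolding phase_def by (intro continuous_intros continuous_on_cis)
  have meas: "(\<lambda>x. indicator {a..a + 1 / c} x *\<^sub>R phase (b * x)) \<in> borel_measurable borel" by measurable
  have "(LINT x|lebesgue. indicator {a..a + 1 / c} x * phase (b * x)) = (LINT x|lebesgue. indicator {a..a + 1 / c} x *\<^sub>R phase (b * x))"
    by (intro Bochner_Integration.integral_cong) (auto simp: indicator_def)
  also have "\<dots> = (LINT x|lborel. indicator {a..a + 1 / c} x *\<^sub>R phase (b * x))"
    using meas by (intro integral_completion) simp
  also have "\<dots> = phase (b * (a + 1 / c)) / w - phase (b * a) / w"
  proof (rule integral_FTC_Icc)
    fix x
    show "((\<lambda>x. phase (b * x) / w) has_vector_derivative phase (b * x)) (at x within {a..a + 1 / c})"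
    proof -
      have "((\<lambda>x. phase (b * x) * inverse w) has_vector_derivative phase (b * x) * w * inverse w) (at x within {a..a + 1 / c})"
        unfolding w_def by (intro has_vector_derivative_mult_left has_vector_derivative_phase)
      thus ?thesis using w by (simp add: divide_inverse mult.assoc)
    qed
  qed (use c cont in auto)
  also have "phase (b * (a + 1 / c)) = phase (b * a) * phase (of_int m)"
    using c by (simp only: phase_add[symmetric]) (simp add: b_def distrib_left)
  finally show ?thesis using False by (simp add: b_def)
qed

text \<open>Proved by duality. Let S be the sum of the squared coefficients over F and v the
  trigonometric sum with conjugated coefficients. Then the integral of u v is S and the squared norm
  of v is S/c, so Cauchy-Schwarz gives S^2 <= (S/c) times the squared norm of u.\<close>

lemma Bessel_interval:
  assumes c: "0 < c" and u: "u \<in> L2" and supp: "\<And>x. x \<notin> {a..a + 1 / c} \<Longrightarrow> u x = 0"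
    and F: "finite (F :: int set)"
  shows "(\<Sum>k\<in>F. ennreal ((cmod (LINT x|lebesgue. u x * phase (c * of_int k * x)))\<^sup>2)) \<le> ennreal (1 / c) * L2_norm_sq u"
proof -
  have [measurable]: "u \<in> borel_measurable lebesgue" using u by (simp add: L2_def)
  let ?I = "{a..a + 1 / c}"
  define coef where "coef k = (LINT x|lebesgue. u x * phase (c * of_int k * x))" for k :: int
  have cnj_self: "cnj z * z = of_real ((cmod z)\<^sup>2)" for z
    by (simp only: complex_norm_square mult.commute)
  define S where "S = (\<Sum>k\<in>F. (cmod (coef k))\<^sup>2)"
  have S0: "0 \<le> S" unfolding S_def by (intro sum_nonneg) auto
  define v where "v x = indicator ?I x * (\<Sum>k\<in>F. cnj (coef k) * phase (c * of_int k * x))" for x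
  have pm [measurable]: "(\<lambda>x. phase (b * x)) \<in> borel_measurable lebesgue" for b
    by (rule measurable_phase_lebesgue)
  have [measurable]: "v \<in> borel_measurable lebesgue" unfolding v_def by measurable
  have int_ind: "integrable lebesgue (\<lambda>x. indicator ?I x * phase (b * x))" for b
    using integrable_mult_phase[OF integrable_indicator_compact[OF compact_Icc]] .
  have vv: "v x * cnj (v x) = (\<Sum>k\<in>F. \<Sum>l\<in>F. (cnj (coef k) * coef l) * (indicator ?I x * phase (c * of_int (k - l) * x)))" for x
  proof -
    have "v x * cnj (v x) = (\<Sum>k\<in>F. cnj (coef k) * (indicator ?I x * phase (c * of_int k * x))) * (\<Sum>l\<in>F. coef l * phase (- (c * of_int l * x)))"
      by (auto simp: v_def indicator_def cnj_phase)
    also have "\<dots> = (\<Sum>k\<in>F. \<Sum>l\<in>F. (cnj (coef k) * (indicator ?I x * phase (c * of_int k * x))) * (coef l * phase (- (c * of_int l * x))))"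
      by (rule sum_product)
    also have "\<dots> = (\<Sum>k\<in>F. \<Sum>l\<in>F. (cnj (coef k) * coef l) * (indicator ?I x * phase (c * of_int (k - l) * x)))"
    proof (intro sum.cong refl)
      fix k l
      have "c * of_int (k - l) * x = c * of_int k * x + - (c * of_int l * x)"
        by (simp add: algebra_simps)
      hence "phase (c * of_int (k - l) * x) = phase (c * of_int k * x) * phase (- (c * of_int l * x))"
        by (simp only: phase_add)
      thus "(cnj (coef k) * (indicator ?I x * phase (c * of_int k * x))) * (coef l * phase (- (c * of_int l * x)))
          = (cnj (coef k) * coef l) * (indicator ?I x * phase (c * of_int (k - l) * x))"
        by (simp only: mult_ac)
    qed
    finally show ?thesis .
  qed
  have int_vv: "integrable lebesgue (\<lambda>x. v x * cnj (v x))"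
    unfolding vv by (intro Bochner_Integration.integrable_sum integrable_mult_right int_ind)
  have "(LINT x|lebesgue. v x * cnj (v x)) = (\<Sum>k\<in>F. \<Sum>l\<in>F. (cnj (coef k) * coef l) * (LINT x|lebesgue. indicator ?I x * phase (c * of_int (k - l) * x)))"
    unfolding vv by (simp add: int_ind)
  also have "\<dots> = (\<Sum>k\<in>F. \<Sum>l\<in>F. if k = l then (cnj (coef k) * coef l) * of_real (1 / c) else 0)"
    unfolding integral_phase_period[OF c] by (intro sum.cong) auto
  also have "\<dots> = (\<Sum>k\<in>F. (cnj (coef k) * coef k) * of_real (1 / c))"
    using F by (simp add: sum.delta)
  also have "\<dots> = of_real (S / c)"
    unfolding cnj_self S_def by (simp add: sum_divide_distrib)
  finally have ivv: "(LINT x|lebesgue. v x * cnj (v x)) = of_real (S / c)" .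
  have eqv: "v x * cnj (v x) = of_real ((cmod (v x))\<^sup>2)" for x
    by (simp only: complex_norm_square)
  have int_v: "integrable lebesgue (\<lambda>x. (cmod (v x))\<^sup>2)"
    using int_vv unfolding eqv complex_of_real_integrable_eq .
  have "(LINT x|lebesgue. (cmod (v x))\<^sup>2) = S / c"
    using ivv unfolding eqv integral_complex_of_real of_real_eq_iff .
  hence nv: "L2_norm_sq v = ennreal (S / c)"
    unfolding L2_norm_sq_def using int_v by (subst nn_integral_eq_integral) auto
  hence vL2: "v \<in> L2" by (simp add: L2_def)
  have uint: "integrable lebesgue (\<lambda>x. u x * phase (b * x))" for b
    by (intro integrable_mult_phase integrable_L2_bounded_support[OF u]) (rule supp)
  have "u x * v x = (\<Sum>k\<in>F. cnj (coef k) * (u x * phase (c * of_int k * x)))" for x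
    using supp[of x] by (auto simp: v_def indicator_def sum_distrib_left algebra_simps)
  hence "(LINT x|lebesgue. u x * v x) = (\<Sum>k\<in>F. cnj (coef k) * coef k)"
    unfolding coef_def by (simp add: uint)
  also have "\<dots> = of_real S"
    unfolding cnj_self S_def by simp
  finally have "ennreal S = ennreal (cmod (LINT x|lebesgue. u x * v x))"
    using S0 by simp
  also have "\<dots> \<le> (\<integral>\<^sup>+x. ennreal (cmod (u x * v x)) \<partial>lebesgue)"
    by (rule norm_integral_le_nn_integral)
  finally have "(ennreal S)\<^sup>2 \<le> (\<integral>\<^sup>+x. ennreal (cmod (u x * v x)) \<partial>lebesgue)\<^sup>2"
    by (intro power_mono) auto
  also have "\<dots> \<le> L2_norm_sq u * ennreal (S / c)"
    using L2_Cauchy_Schwarz[OF u vL2] unfolding nv .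
  finally have le: "(ennreal S)\<^sup>2 \<le> L2_norm_sq u * ennreal (S / c)" .
  obtain U where U: "L2_norm_sq u = ennreal U" "0 \<le> U"
    using u by (cases "L2_norm_sq u") (auto simp: L2_def)
  have "S\<^sup>2 \<le> U * (S / c)"
    using le S0 U c by (simp add: U ennreal_power ennreal_mult[symmetric])
  \<comment> \<open>One factor S is cancelled, which requires S = 0 to be treated apart.\<close>
  hence "S \<le> 1 / c * U"
    using S0 c U(2) by (cases "S = 0") (auto simp: power2_eq_square field_simps)
  hence "ennreal S \<le> ennreal (1 / c) * L2_norm_sq u"
    using c U by (simp add: U ennreal_mult[symmetric])
  moreover have "(\<Sum>k\<in>F. ennreal ((cmod (coef k))\<^sup>2)) = ennreal S"
    unfolding S_def by (intro sum_ennreal) auto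
  ultimately show ?thesis unfolding coef_def by simp
qed

text \<open>Cut the interval into N pieces of length 1/c. Cauchy-Schwarz for the sum over the pieces
  costs a factor N, Bessel on each piece gives 1/c, and N/c <= 1/c + \<delta>.\<close>

lemma Bessel_long_interval:
  assumes c: "0 < c" and \<delta>: "0 \<le> \<delta>" and u: "u \<in> L2" and supp: "\<And>x. x \<notin> {a..a + \<delta>} \<Longrightarrow> u x = 0"
    and F: "finite (F :: int set)"
  shows "(\<Sum>k\<in>F. ennreal ((cmod (LINT x|lebesgue. u x * phase (c * of_int k * x)))\<^sup>2)) \<le> ennreal (1 / c + \<delta>) * L2_norm_sq u"
proof -
  have um [measurable]: "u \<in> borel_measurable lebesgue" using u by (simp add: L2_def)
  \<comment> \<open>The pieces are half-open, so that they are disjoint; adding 1 to the floor gives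
    \<delta> c < N, and the right endpoint is covered too.\<close>
  define N where "N = nat (\<lfloor>\<delta> * c\<rfloor> + 1)"
  have "0 \<le> \<delta> * c" using \<delta> c by simp
  hence N: "\<delta> * c < real N" "real N \<le> \<delta> * c + 1"
    unfolding N_def by linarith+
  define piece where "piece n = {a + real n / c..<a + (real n + 1) / c}" for n :: nat
  have cover: "\<exists>!n. n < N \<and> x \<in> piece n" if x: "x \<in> {a..a + \<delta>}" for x
  proof -
    have iff: "x \<in> piece n \<longleftrightarrow> \<lfloor>(x - a) * c\<rfloor> = int n" for n
      unfolding piece_def floor_eq_iff using c by (auto simp: field_simps)
    have "0 \<le> (x - a) * c" using x c by auto
    moreover have "(x - a) * c \<le> \<delta> * c" using x c by (intro mult_right_mono) auto
    ultimately have "0 \<le> \<lfloor>(x - a) * c\<rfloor>" "\<lfloor>(x - a) * c\<rfloor> < int N"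
      using N(1) by (simp, linarith)
    thus ?thesis unfolding iff by (intro ex1I[of _ "nat \<lfloor>(x - a) * c\<rfloor>"]) (auto simp: nat_less_iff)
  qed
  define w where "w n x = indicator (piece n) x * u x" for n x
  have sum1: "(\<Sum>n<N. h n) = h m" if "m < N" "\<And>n. n < N \<Longrightarrow> n \<noteq> m \<Longrightarrow> h n = 0" for m and h :: "nat \<Rightarrow> 'b::comm_monoid_add"
    using that by (subst sum.mono_neutral_right[of _ "{m}"]) auto
  have usum: "u x = (\<Sum>n<N. w n x)" and nsum: "(\<Sum>n<N. ennreal ((cmod (w n x))\<^sup>2)) = ennreal ((cmod (u x))\<^sup>2)" for x
  proof -
    have "u x = (\<Sum>n<N. w n x) \<and> (\<Sum>n<N. ennreal ((cmod (w n x))\<^sup>2)) = ennreal ((cmod (u x))\<^sup>2)"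
    proof (cases "x \<in> {a..a + \<delta>}")
      case True
      then obtain m where m: "m < N" "x \<in> piece m" "\<And>n. n < N \<Longrightarrow> n \<noteq> m \<Longrightarrow> x \<notin> piece n"
        using cover by blast
      show ?thesis
        by (subst (1 2) sum1[OF m(1)]) (use m in \<open>auto simp: w_def\<close>)
    qed (simp add: w_def supp)
    thus "u x = (\<Sum>n<N. w n x)" "(\<Sum>n<N. ennreal ((cmod (w n x))\<^sup>2)) = ennreal ((cmod (u x))\<^sup>2)" by auto
  qed
  have [measurable]: "piece n \<in> sets lebesgue" for n by (simp add: piece_def)
  have wm [measurable]: "w n \<in> borel_measurable lebesgue" for n unfolding w_def by measurable
  have wL2: "w n \<in> L2" for n
  proof -
    have "L2_norm_sq (w n) \<le> L2_norm_sq u"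
      unfolding L2_norm_sq_def by (intro nn_integral_mono) (auto simp: w_def indicator_def)
    thus ?thesis using u by (auto simp: L2_def intro: order.strict_trans1)
  qed
  have wint: "integrable lebesgue (\<lambda>x. w n x * phase (b * x))" for n b
    by (intro integrable_mult_phase integrable_L2_bounded_support[OF wL2, where a = a and b = "a + \<delta>"])
       (auto simp: w_def indicator_def supp)
  let ?z = "\<lambda>n k. LINT x|lebesgue. w n x * phase (c * of_int k * x)"
  have "(\<Sum>k\<in>F. ennreal ((cmod (LINT x|lebesgue. u x * phase (c * of_int k * x)))\<^sup>2)) \<le> (\<Sum>k\<in>F. \<Sum>n<N. ennreal (real N) * ennreal ((cmod (?z n k))\<^sup>2))"
  proof (intro sum_mono)
    fix k
    have "(LINT x|lebesgue. u x * phase (c * of_int k * x)) = (\<Sum>n<N. ?z n k)"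
      unfolding usum sum_distrib_right by (rule Bochner_Integration.integral_sum) (rule wint)
    hence "(cmod (LINT x|lebesgue. u x * phase (c * of_int k * x)))\<^sup>2 \<le> (\<Sum>n<N. cmod (?z n k))\<^sup>2"
      by (intro power_mono) (auto intro: sum_norm_le)
    also have "\<dots> \<le> (\<Sum>n<N. (cmod (?z n k))\<^sup>2) * real N"
      using sum_squared_le_sum_of_squares[of "\<lambda>n. cmod (?z n k)" "{..<N}"] by simp
    also have "\<dots> = (\<Sum>n<N. real N * (cmod (?z n k))\<^sup>2)"
      by (simp add: sum_distrib_left mult.commute)
    finally have "ennreal ((cmod (LINT x|lebesgue. u x * phase (c * of_int k * x)))\<^sup>2) \<le> ennreal (\<Sum>n<N. real N * (cmod (?z n k))\<^sup>2)"
      by (rule ennreal_leI)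
    also have "\<dots> = (\<Sum>n<N. ennreal (real N) * ennreal ((cmod (?z n k))\<^sup>2))"
      by (subst sum_ennreal[symmetric]) (auto simp: ennreal_mult)
    finally show "ennreal ((cmod (LINT x|lebesgue. u x * phase (c * of_int k * x)))\<^sup>2) \<le> (\<Sum>n<N. ennreal (real N) * ennreal ((cmod (?z n k))\<^sup>2))" .
  qed
  also have "\<dots> = (\<Sum>n<N. ennreal (real N) * (\<Sum>k\<in>F. ennreal ((cmod (?z n k))\<^sup>2)))"
    by (subst sum.swap) (simp only: sum_distrib_left)
  also have "\<dots> \<le> (\<Sum>n<N. ennreal (real N) * (ennreal (1 / c) * L2_norm_sq (w n)))"
  proof (intro sum_mono mult_left_mono Bessel_interval[where a = "a + real n / c" for n] c wL2 F)
    fix n x assume "x \<notin> {a + real n / c..a + real n / c + 1 / c}"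
    thus "w n x = 0" by (auto simp: w_def piece_def indicator_def add_divide_distrib)
  qed auto
  also have "\<dots> = ennreal (real N / c) * (\<Sum>n<N. L2_norm_sq (w n))"
    using c by (simp add: sum_distrib_left mult.assoc[symmetric] ennreal_mult[symmetric])
  also have "(\<Sum>n<N. L2_norm_sq (w n)) = L2_norm_sq u"
    unfolding L2_norm_sq_def by (subst nn_integral_sum[symmetric]) (auto simp: nsum)
  also have "ennreal (real N / c) * L2_norm_sq u \<le> ennreal (1 / c + \<delta>) * L2_norm_sq u"
    using N(2) c by (intro mult_right_mono ennreal_leI) (auto simp: field_simps)
  finally show ?thesis .
qed

subsection \<open>The lower frame inequality on compact sets\<close>

text \<open>A sum of nonnegative terms is the supremum of its finite partial sums, and a countable
  index set has only countably many finite subsets.\<close>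

lemma borel_measurable_infsum_ennreal:
  fixes f :: "'i \<Rightarrow> 'a \<Rightarrow> ennreal"
  assumes "countable I" "\<And>i. i \<in> I \<Longrightarrow> f i \<in> borel_measurable M"
  shows "(\<lambda>x. \<Sum>\<^sub>\<infinity>i\<in>I. f i x) \<in> borel_measurable M"
proof -
  have "(\<lambda>x. \<Sum>\<^sub>\<infinity>i\<in>I. f i x) = (\<lambda>x. SUP F\<in>{F. finite F \<and> F \<subseteq> I}. \<Sum>i\<in>F. f i x)"
    by (intro ext nonneg_infsum_complete) auto
  also have "\<dots> \<in> borel_measurable M"
    using assms by (intro borel_measurable_SUP countable_Collect_finite_subset borel_measurable_sum) auto
  finally show ?thesis .
qed

lemma sum_le_infsum_ennreal:
  fixes f :: "'i \<Rightarrow> ennreal"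
  assumes "finite F" "F \<subseteq> I"
  shows "sum f F \<le> (\<Sum>\<^sub>\<infinity>i\<in>I. f i)"
  using assms by (subst nonneg_infsum_complete) (auto intro!: SUP_upper)

lemma infsum_le_ennreal:
  fixes f :: "'i \<Rightarrow> ennreal"
  assumes "\<And>F. finite F \<Longrightarrow> F \<subseteq> I \<Longrightarrow> sum f F \<le> b"
  shows "(\<Sum>\<^sub>\<infinity>i\<in>I. f i) \<le> b"
  using assms by (subst nonneg_infsum_complete) (auto intro!: SUP_least)

text \<open>A compact set on which H < A must be null, since otherwise the integral of H over it
  would fall short of A times its measure. Inner regularity extends this to the whole set where H <
  A.\<close>

lemma AE_ge_of_compact_averages:
  fixes H :: "real \<Rightarrow> ennreal"
  assumes H [measurable]: "H \<in> borel_measurable lebesgue" and \<delta>: "0 < \<delta>"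
    and le: "\<And>K a. compact K \<Longrightarrow> K \<subseteq> {a..a + \<delta>} \<Longrightarrow> ennreal A * emeasure lebesgue K \<le> (\<integral>\<^sup>+x\<in>K. H x \<partial>lebesgue)"
  shows "AE x in lebesgue. ennreal A \<le> H x"
proof -
  \<comment> \<open>The exceptional set is cut into windows of length \<delta>, as the hypothesis
    only covers compact sets inside such an interval.\<close>
  define D where "D m = {x \<in> {of_int m * \<delta>..of_int m * \<delta> + \<delta>}. H x < ennreal A}" for m :: int
  have Dm [measurable]: "D m \<in> sets lebesgue" for m
  proof -
    have "{x \<in> space lebesgue. H x < ennreal A} \<in> sets lebesgue" by measurable
    hence "{of_int m * \<delta>..of_int m * \<delta> + \<delta>} \<inter> {x \<in> space lebesgue. H x < ennreal A} \<in> sets lebesgue"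
      by (intro sets.Int) auto
    also have "{of_int m * \<delta>..of_int m * \<delta> + \<delta>} \<inter> {x \<in> space lebesgue. H x < ennreal A} = D m"
      by (auto simp: D_def)
    finally show ?thesis .
  qed
  have compact_null: "emeasure lebesgue C = 0" if C: "compact C" "C \<subseteq> D m" for C m
  proof -
    have Cm [measurable]: "C \<in> sets lebesgue" using C(1) by (simp add: borel_compact)
    have Cfin: "emeasure lebesgue C < \<infinity>" using emeasure_compact_finite[OF C(1)] C(1) by (simp add: borel_compact)
    \<comment> \<open>\<open>?Y\<close> is the integrated deficit. As \<open>?X + ?Y\<close> equals
      A times the measure of C, which is at most \<open>?X\<close>, and \<open>?X\<close> is finite,
      the deficit vanishes.\<close>
    let ?X = "\<integral>\<^sup>+x\<in>C. H x \<partial>lebesgue" and ?Y = "\<integral>\<^sup>+x\<in>C. (ennreal A - H x) \<partial>lebesgue"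
    have below: "H x < ennreal A" if "x \<in> C" for x using that C(2) by (auto simp: D_def)
    have "?X + ?Y = (\<integral>\<^sup>+x. H x * indicator C x + (ennreal A - H x) * indicator C x \<partial>lebesgue)"
      by (intro nn_integral_add[symmetric]) measurable
    also have "\<dots> = (\<integral>\<^sup>+x. ennreal A * indicator C x \<partial>lebesgue)"
    proof (intro nn_integral_cong)
      fix x
      show "H x * indicator C x + (ennreal A - H x) * indicator C x = ennreal A * indicator C x"
        using below[of x] by (cases "x \<in> C") (auto simp: diff_add_cancel_ennreal add.commute)
    qed
    also have "\<dots> = ennreal A * emeasure lebesgue C" by (rule nn_integral_cmult_indicator) measurable
    finally have eq: "?X + ?Y = ennreal A * emeasure lebesgue C" .
    have "ennreal A * emeasure lebesgue C \<le> ?X"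
      using C(2) by (intro le C(1)) (auto simp: D_def)
    with eq have "?X + ?Y \<le> ?X + 0" by simp
    moreover have "?X \<noteq> top"
    proof -
      have "?X + ?Y < top"
        unfolding eq using Cfin by (simp add: ennreal_mult_less_top)
      thus ?thesis by auto
    qed
    ultimately have "?Y = 0"
      by (subst (asm) ennreal_add_left_cancel_le) auto
    hence "AE x in lebesgue. (ennreal A - H x) * indicator C x = 0"
      by (subst (asm) nn_integral_0_iff_AE) auto
    hence "AE x in lebesgue. x \<notin> C"
    proof eventually_elim
      case (elim x)
      show ?case
      proof
        assume "x \<in> C"
        thus False using elim below[of x] by (simp add: diff_eq_0_iff_ennreal)
      qed
    qed
    thus "emeasure lebesgue C = 0"
      using AE_iff_null_sets[OF Cm] by (simp add: null_sets_def)
  qed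
  have "D m \<in> null_sets lebesgue" for m
  proof -
    have "emeasure lebesgue (D m) \<le> 0"
    proof (rule ennreal_le_epsilon)
      fix e :: real assume e: "0 < e"
      obtain T where T: "closed T" "T \<subseteq> D m" "D m - T \<in> lmeasurable" "emeasure lebesgue (D m - T) < ennreal e"
        by (rule sets_lebesgue_inner_closed[OF Dm e])
      have "bounded T" by (rule bounded_subset[of "{of_int m * \<delta>..of_int m * \<delta> + \<delta>}"]) (use T(2) in \<open>auto simp: D_def\<close>)
      hence C: "compact T" using T(1) by (simp add: compact_eq_bounded_closed)
      have "emeasure lebesgue (D m) = emeasure lebesgue (T \<union> (D m - T))"
        using T(2) by (simp add: Un_absorb1)
      also have "\<dots> \<le> emeasure lebesgue T + emeasure lebesgue (D m - T)"
        using T(1,3) by (intro emeasure_subadditive) auto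
      also have "\<dots> \<le> 0 + ennreal e"
        using compact_null[OF C T(2)] T(4) by (intro add_mono) auto
      finally show "emeasure lebesgue (D m) \<le> 0 + ennreal e" .
    qed
    thus ?thesis by (simp add: null_sets_def)
  qed
  hence "AE x in lebesgue. \<forall>m. x \<notin> D m"
    by (subst AE_all_countable) (blast intro: AE_not_in)
  thus ?thesis
  proof eventually_elim
    case (elim x)
    have "x \<in> {of_int \<lfloor>x / \<delta>\<rfloor> * \<delta>..of_int \<lfloor>x / \<delta>\<rfloor> * \<delta> + \<delta>}"
      using \<delta> floor_divide_lower[of \<delta> x] floor_divide_upper[of \<delta> x] by (auto simp: algebra_simps)
    thus ?case using elim by (auto simp: D_def not_less)
  qed
qed

text \<open>The conjugated transform of the indicator is its inverse transform, written without
  introducing a second transform. Moving the translation onto the other factor modulates the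
  indicator, and the multiplication formula then passes the transform to g.\<close>

lemma frame_coefficient:
  assumes K: "compact K" and g: "g \<in> L2"
  shows "cmod (L2_inner (\<lambda>x. cnj (fourier_L1 (indicator K) x)) (translation s g))
       = cmod (LINT x|lebesgue. indicator K x * fourier_L2 g x * phase (s * x))"
proof -
  have Kb [measurable]: "K \<in> sets borel" using K by (simp add: borel_compact)
  hence Kl [measurable]: "K \<in> sets lebesgue" by auto
  have Kfin: "emeasure lebesgue K < \<infinity>" using emeasure_compact_finite[OF K] by simp
  have ind: "integrable lebesgue (indicator K :: real \<Rightarrow> complex)"
    by (rule integrable_indicator_compact) fact
  define u where "u x = indicator K x * phase (s * x)" for x
  have uint: "integrable lebesgue u" unfolding u_def using ind by (rule integrable_mult_phase)
  have "L2_norm_sq u = (\<integral>\<^sup>+x. indicator K x \<partial>lebesgue)"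
    unfolding L2_norm_sq_def by (intro nn_integral_cong) (auto simp: u_def indicator_def)
  hence uL2: "u \<in> L2" using uint Kfin by (auto simp: L2_def)
  \<comment> \<open>The shape \<open>s + 1 * x\<close> matches the affine change of variable
    below.\<close>
  have hat_u: "fourier_L1 u x = fourier_L1 (indicator K) (s + 1 * x)" for x
    by (simp add: u_def fourier_L1_phase mult.assoc phase_add[symmetric] algebra_simps)
  have "L2_inner (\<lambda>x. cnj (fourier_L1 (indicator K) x)) (translation s g) = cnj (LINT x|lebesgue. fourier_L1 (indicator K) x * g (x - s))"
    unfolding L2_inner_def translation_def Bochner_Integration.integral_cnj[symmetric] by simp
  also have "(LINT x|lebesgue. fourier_L1 (indicator K) x * g (x - s)) = (LINT x|lebesgue. fourier_L1 u x * g x)"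
    unfolding hat_u by (subst lebesgue_integral_real_affine[where c = 1 and t = s]) auto
  also have "\<dots> = (LINT x|lebesgue. u x * fourier_L2 g x)"
    by (rule fourier_L2_multiplication_formula[OF uint uL2 g])
  finally show ?thesis by (simp add: u_def mult_ac)
qed

text \<open>The lower frame inequality is tested on the inverse transform f of the indicator of K.
  Since f has squared norm at least the measure of K, it remains to bound the coefficients of each
  generator by Bessel's inequality on an interval of length \<delta>.\<close>

lemma frame_lower_bound_compact:
  fixes J :: "'j set" and g :: "'j \<Rightarrow> real \<Rightarrow> complex"
  assumes J: "countable J" and c: "\<And>j. j \<in> J \<Longrightarrow> 0 < c j" and g: "\<And>j. j \<in> J \<Longrightarrow> g j \<in> L2"
    and frame: "frame_with_lower_bound (UNIV \<times> J) (gsi_system c g) A"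
    and \<delta>: "0 < \<delta>" and K: "compact K" "K \<subseteq> {a..a + \<delta>}"
  shows "ennreal A * emeasure lebesgue K \<le>
    (\<integral>\<^sup>+x\<in>K. ((\<Sum>\<^sub>\<infinity>j\<in>J. ennreal (1 / c j * (cmod (fourier_L2 (g j) x))\<^sup>2)) +
       ennreal \<delta> * (\<Sum>\<^sub>\<infinity>j\<in>J. ennreal ((cmod (fourier_L2 (g j) x))\<^sup>2))) \<partial>lebesgue)"
    (is "_ \<le> (\<integral>\<^sup>+x\<in>K. (?S x + ennreal \<delta> * ?Q x) \<partial>lebesgue)")
proof -
  have Kb [measurable]: "K \<in> sets borel" using K(1) by (simp add: borel_compact)
  hence Kl [measurable]: "K \<in> sets lebesgue" by auto
  have Kfin: "emeasure lebesgue K < \<infinity>" using emeasure_compact_finite[OF K(1)] by simp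
  have ind: "integrable lebesgue (indicator K :: real \<Rightarrow> complex)"
    by (rule integrable_indicator_compact) fact
  define G where "G j = fourier_L2 (g j)" for j
  have GL2: "G j \<in> L2" if "j \<in> J" for j unfolding G_def by (intro fourier_L2_in_L2 g that)
  define f where "f x = cnj (fourier_L1 (indicator K) x)" for x
  have nf: "L2_norm_sq f = L2_norm_sq (fourier_L1 (indicator K))"
    by (simp add: L2_norm_sq_def f_def)
  have "L2_norm_sq (indicator K) = (\<integral>\<^sup>+x. indicator K x \<partial>lebesgue)"
    unfolding L2_norm_sq_def by (intro nn_integral_cong) (auto simp: indicator_def)
  also have "\<dots> < \<infinity>" using Kfin by simp
  finally have "L2_norm_sq f < \<infinity>"
    unfolding nf by (rule order.strict_trans1[OF fourier_L1_contraction[OF ind]])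
  moreover have "f \<in> borel_measurable lebesgue"
    unfolding f_def
    by (intro borel_measurable_continuous_on[of cnj] borel_measurable_fourier_L1 borel_measurable_integrable[OF ind] continuous_intros)
  ultimately have fL2: "f \<in> L2" by (simp add: L2_def)
  have "ennreal A * emeasure lebesgue K \<le> ennreal A * L2_norm_sq f"
    unfolding nf by (intro mult_left_mono L2_norm_sq_fourier_indicator K) auto
  also have "\<dots> \<le> (\<Sum>\<^sub>\<infinity>i\<in>UNIV \<times> J. ennreal ((cmod (L2_inner f (gsi_system c g i)))\<^sup>2))"
    using frame fL2 unfolding frame_with_lower_bound_def frame_bounds_def by blast
  also have "\<dots> \<le> (\<integral>\<^sup>+x\<in>K. (?S x + ennreal \<delta> * ?Q x) \<partial>lebesgue)"
  proof (rule infsum_le_ennreal)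
    fix F :: "(int \<times> 'j) set" assume F: "finite F" "F \<subseteq> UNIV \<times> J"
    \<comment> \<open>A finite set of index pairs is enlarged to a finite rectangle, so that for
      each j the sum over k can be taken first.\<close>
    define F1 where "F1 = fst ` F"
    define F2 where "F2 = snd ` F"
    have fin: "finite F1" "finite F2" and F2J: "F2 \<subseteq> J" and sub: "F \<subseteq> F1 \<times> F2"
      using F by (force simp: F1_def F2_def)+
    define b where "b k j = ennreal ((cmod (LINT x|lebesgue. indicator K x * G j x * phase (c j * of_int k * x)))\<^sup>2)" for k :: int and j
    have "(\<Sum>i\<in>F. ennreal ((cmod (L2_inner f (gsi_system c g i)))\<^sup>2)) = (\<Sum>i\<in>F. b (fst i) (snd i))"
    proof (intro sum.cong refl)
      fix i assume "i \<in> F"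
      then obtain k j where i: "i = (k, j)" "j \<in> J" using F(2) by auto
      show "ennreal ((cmod (L2_inner f (gsi_system c g i)))\<^sup>2) = b (fst i) (snd i)"
        unfolding i b_def G_def f_def gsi_system_def by (simp add: frame_coefficient[OF K(1) g[OF i(2)]])
    qed
    also have "\<dots> \<le> (\<Sum>i\<in>F1 \<times> F2. b (fst i) (snd i))"
      using fin sub by (intro sum_mono2) auto
    also have "\<dots> = (\<Sum>k\<in>F1. \<Sum>j\<in>F2. b k j)"
      by (simp add: sum.cartesian_product split_def)
    also have "\<dots> = (\<Sum>j\<in>F2. \<Sum>k\<in>F1. b k j)"
      by (rule sum.swap)
    also have "\<dots> \<le> (\<Sum>j\<in>F2. \<integral>\<^sup>+x\<in>K. (ennreal (1 / c j * (cmod (G j x))\<^sup>2) + ennreal \<delta> * ennreal ((cmod (G j x))\<^sup>2)) \<partial>lebesgue)"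
    proof (intro sum_mono)
      fix j assume "j \<in> F2"
      hence j: "j \<in> J" using F2J by auto
      have Gm [measurable]: "G j \<in> borel_measurable lebesgue" using GL2[OF j] by (simp add: L2_def)
      have "L2_norm_sq (\<lambda>x. indicator K x * G j x) \<le> L2_norm_sq (G j)"
        unfolding L2_norm_sq_def by (intro nn_integral_mono) (auto simp: indicator_def)
      hence KG: "(\<lambda>x. indicator K x * G j x) \<in> L2"
        using GL2[OF j] by (auto simp: L2_def intro: order.strict_trans1)
      have "(\<Sum>k\<in>F1. b k j) \<le> ennreal (1 / c j + \<delta>) * L2_norm_sq (\<lambda>x. indicator K x * G j x)"
        unfolding b_def using K(2) \<delta>
        by (intro Bessel_long_interval[where a = a] c j KG fin) (auto simp: indicator_def)
      also have "\<dots> = (\<integral>\<^sup>+x. ennreal (1 / c j + \<delta>) * ennreal ((cmod (indicator K x * G j x))\<^sup>2) \<partial>lebesgue)"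
        unfolding L2_norm_sq_def by (intro nn_integral_cmult[symmetric]) measurable
      also have "\<dots> = (\<integral>\<^sup>+x\<in>K. (ennreal (1 / c j * (cmod (G j x))\<^sup>2) + ennreal \<delta> * ennreal ((cmod (G j x))\<^sup>2)) \<partial>lebesgue)"
        using c[OF j] \<delta>
        by (intro nn_integral_cong) (auto simp: indicator_def ennreal_mult[symmetric] ennreal_plus[symmetric] distrib_right simp del: ennreal_plus)
      finally show "(\<Sum>k\<in>F1. b k j) \<le> (\<integral>\<^sup>+x\<in>K. (ennreal (1 / c j * (cmod (G j x))\<^sup>2) + ennreal \<delta> * ennreal ((cmod (G j x))\<^sup>2)) \<partial>lebesgue)" .
    qed
    also have "\<dots> = (\<integral>\<^sup>+x. (\<Sum>j\<in>F2. (ennreal (1 / c j * (cmod (G j x))\<^sup>2) + ennreal \<delta> * ennreal ((cmod (G j x))\<^sup>2)) * indicator K x) \<partial>lebesgue)"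
    proof (intro nn_integral_sum[symmetric])
      fix j assume "j \<in> F2"
      hence Gm [measurable]: "G j \<in> borel_measurable lebesgue" using GL2 F2J by (auto simp: L2_def)
      show "(\<lambda>x. (ennreal (1 / c j * (cmod (G j x))\<^sup>2) + ennreal \<delta> * ennreal ((cmod (G j x))\<^sup>2)) * indicator K x) \<in> borel_measurable lebesgue"
        by measurable
    qed
    \<comment> \<open>The finite sums are compared with the infinite ones pointwise, under the
      integral.\<close>
    also have "\<dots> \<le> (\<integral>\<^sup>+x\<in>K. (?S x + ennreal \<delta> * ?Q x) \<partial>lebesgue)"
      unfolding sum_distrib_right[symmetric] sum.distrib sum_distrib_left[symmetric] G_def
      by (intro nn_integral_mono mult_right_mono add_mono mult_left_mono sum_le_infsum_ennreal fin F2J) auto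
    finally show "(\<Sum>i\<in>F. ennreal ((cmod (L2_inner f (gsi_system c g i)))\<^sup>2)) \<le> (\<integral>\<^sup>+x\<in>K. (?S x + ennreal \<delta> * ?Q x) \<partial>lebesgue)" .
  qed
  finally show ?thesis .
qed

section \<open>From compact sets to almost every frequency\<close>

theorem theorem3p1:
  fixes J :: "'j set"
    and c :: "'j \<Rightarrow> real"
    and g :: "'j \<Rightarrow> real \<Rightarrow> complex"
    and E :: "real set"
    and A :: real
  assumes "countable J"
    and "\<And>j. j \<in> J \<Longrightarrow> 0 < c j"
    and "\<And>j. j \<in> J \<Longrightarrow> g j \<in> L2"
    and "E \<in> sets lebesgue"
    and "closure E \<in> null_sets lebesgue"
    and "(\<lambda>\<gamma>. \<Sum>\<^sub>\<infinity>j\<in>J. ennreal ((cmod (fourier_L2 (g j) \<gamma>))\<^sup>2)) \<in> L1_loc (UNIV - E)"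
    and "frame_with_lower_bound (UNIV \<times> J) (gsi_system c g) A"
  shows "AE \<gamma> in lebesgue.
           ennreal A \<le> (\<Sum>\<^sub>\<infinity>j\<in>J. ennreal (1 / c j * (cmod (fourier_L2 (g j) \<gamma>))\<^sup>2))"
proof -
  define S where "S \<gamma> = (\<Sum>\<^sub>\<infinity>j\<in>J. ennreal (1 / c j * (cmod (fourier_L2 (g j) \<gamma>))\<^sup>2))" for \<gamma>
  define Q where "Q \<gamma> = (\<Sum>\<^sub>\<infinity>j\<in>J. ennreal ((cmod (fourier_L2 (g j) \<gamma>))\<^sup>2))" for \<gamma>
  have Gm: "fourier_L2 (g j) \<in> borel_measurable lebesgue" if "j \<in> J" for j
    using fourier_L2_in_L2[OF assms(3)[OF that]] by (simp add: L2_def)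
  have Sm [measurable]: "S \<in> borel_measurable lebesgue" and Qm [measurable]: "Q \<in> borel_measurable lebesgue"
    unfolding S_def[abs_def] Q_def[abs_def]
    by (intro borel_measurable_infsum_ennreal assms(1), use Gm in measurable)+
  \<comment> \<open>The length \<delta> runs through the countable sequence 1/(n+1), so that the
    exceptional null sets can be united.\<close>
  have "AE \<gamma> in lebesgue. ennreal A \<le> S \<gamma> + ennreal (1 / real (Suc n)) * Q \<gamma>" for n
  proof (rule AE_ge_of_compact_averages)
    fix K a assume "compact K" "K \<subseteq> {a..a + 1 / real (Suc n)}"
    thus "ennreal A * emeasure lebesgue K \<le> (\<integral>\<^sup>+\<gamma>\<in>K. (S \<gamma> + ennreal (1 / real (Suc n)) * Q \<gamma>) \<partial>lebesgue)"
      unfolding S_def Q_def by (intro frame_lower_bound_compact[OF assms(1-3,7)]) auto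
  qed (use Sm Qm in auto)
  hence bound: "AE \<gamma> in lebesgue. \<forall>n. ennreal A \<le> S \<gamma> + ennreal (1 / real (Suc n)) * Q \<gamma>"
    by (subst AE_all_countable) blast
  \<comment> \<open>The complement of the closure of E is open, hence a countable union of compact
    sets. Each of them avoids E, so local integrability makes Q finite almost everywhere on it; the
    closure itself is null.\<close>
  obtain C :: "nat \<Rightarrow> real set" where C: "\<And>n. compact (C n)" "\<And>n. C n \<subseteq> - closure E" "\<Union> (range C) = - closure E"
    by (rule open_Union_compact_subsets[of "- closure E"]) (use open_Compl[OF closed_closure] in auto)
  have "AE \<gamma> in lebesgue. \<gamma> \<in> C n \<longrightarrow> Q \<gamma> < \<infinity>" for n
  proof -
    have "C n \<subseteq> UNIV - E" using C(2)[of n] closure_subset[of E] by auto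
    hence "(\<integral>\<^sup>+\<gamma>\<in>C n. Q \<gamma> \<partial>lebesgue) < \<infinity>"
      using assms(6) C(1)[of n] unfolding Q_def L1_loc_def by auto
    moreover have [measurable]: "C n \<in> sets lebesgue" using C(1)[of n] by (simp add: borel_compact)
    ultimately have "AE \<gamma> in lebesgue. Q \<gamma> * indicator (C n) \<gamma> \<noteq> \<infinity>"
      by (intro nn_integral_PInf_AE) auto
    thus ?thesis by eventually_elim (auto simp: less_top)
  qed
  hence "AE \<gamma> in lebesgue. \<forall>n. \<gamma> \<in> C n \<longrightarrow> Q \<gamma> < \<infinity>"
    by (subst AE_all_countable) blast
  with bound AE_not_in[OF assms(5)] show ?thesis
    unfolding S_def[symmetric]
  proof eventually_elim
    case (elim \<gamma>)
    then obtain q where q: "Q \<gamma> = ennreal q" "0 \<le> q"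
      using C(3) by (cases "Q \<gamma>") auto
    show ?case
    proof (rule ennreal_le_epsilon)
      fix e :: real assume e: "0 < e"
      \<comment> \<open>At a fixed point the value q of Q is finite, and q/(n+1) <= e as soon as n >
        q/e.\<close>
      then obtain n :: nat where n: "q / e < real n" using reals_Archimedean2 by blast
      have "ennreal A \<le> S \<gamma> + ennreal (1 / real (Suc n)) * ennreal q"
        using elim(1) q(1) by metis
      also have "\<dots> = S \<gamma> + ennreal (1 / real (Suc n) * q)"
        using q(2) by (simp only: ennreal_mult[symmetric] zero_le_divide_1_iff of_nat_0_le_iff)
      also have "\<dots> \<le> S \<gamma> + ennreal e"
        using n e by (intro add_left_mono ennreal_leI) (auto simp: field_simps)
      finally show "ennreal A \<le> S \<gamma> + ennreal e" .
    qed
  qed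
qed

end
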